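(* Given $\lambda \ge 4$, let $\varepsilon > 0$ be sufficiently small, and let $n,k \in \mathbb{N}$ be sufficiently large. If $A \subset [n]$ is chosen uniformly at random from the sets with $|A| = k$ and $|A+A| \le \lambda k$, then with probability at least $\varepsilon$, $$|P| \ge \frac{\lambda k}{2} + 2^{-6}\lambda^2\log(1/\varepsilon)$$ for every arithmetic progression $P$ containing $A$.
   Context: $[n] = \{1,\ldots,n\}$; $A + A = \{a+a' : a,a' \in A\}$; $\log$ is the natural logarithm. An arithmetic progression is a finite set of integers of the form $\{a, a+d, \ldots, a+(\ell-1)d\}$ with $d \ge 1$, and $|P|$ denotes its number of elements. It is assumed throughout, for simplicity, that $\lambda k/2$ is an integer.
   Formalization: "n, k sufficiently large" is taken to mean that k and n − λk/2 both exceed a constant depending only on λ and ε; with independent thresholds the claim fails, e.g. for λ = 4 and n = k, where A = [k] lies in a progression of length k < 2k. *)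

theory Defs
  imports "HOL-Probability.Probability" "HOL-Library.Set_Algebras"
begin

definition is_arith_prog :: "int set \<Rightarrow> bool" where
  "is_arith_prog P \<longleftrightarrow>
     (\<exists>a d :: int. \<exists>l :: nat. d \<ge> 1 \<and> l \<ge> 1 \<and> P = (\<lambda>i. a + int i * d) ` {..<l})"

(* "A + A" is the sumset, i.e. addition of sets from Set_Algebras. *)
definition small_sumset_family :: "real \<Rightarrow> nat \<Rightarrow> nat \<Rightarrow> int set set" where
  "small_sumset_family lam n k =
     {A. A \<subseteq> {1..int n} \<and> card A = k \<and> real (card (A + A)) \<le> lam * real k}"

(* The uniform distribution pmf_of_set on the family is only meaningful when the family is
   finite and nonempty; the next two facts show that it is, for k \<le> n and lam \<ge> 2. *)
lemma finite_small_sumset_family: "finite (small_sumset_family lam n k)"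
  by (rule finite_subset[of _ "Pow {1..int n}"]) (auto simp: small_sumset_family_def)

lemma small_sumset_family_nonempty:
  assumes "k \<le> n" and "lam \<ge> 2"
  shows "small_sumset_family lam n k \<noteq> {}"
proof -
  have "{1..int k} + {1..int k} \<subseteq> {1..2 * int k}"
    by (auto simp: set_plus_def)
  then have "card ({1..int k} + {1..int k}) \<le> 2 * k"
    using card_mono[of "{1..2 * int k}" "{1..int k} + {1..int k}"] by simp
  then have "real (card ({1..int k} + {1..int k})) \<le> 2 * real k"
    by linarith
  also have "\<dots> \<le> lam * real k"
    using assms(2) by (intro mult_right_mono) auto
  finally have "{1..int k} \<in> small_sumset_family lam n k"
    using assms(1) by (auto simp: small_sumset_family_def)
  then show ?thesis by blast
qed

end

theory Submission
  imports Defs "HOL-Real_Asymp.Real_Asymp"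
begin

text \<open>
Put \<open>m = lam * k / 2\<close> and \<open>C = lam\<^sup>2 * ln (1 / \<epsilon>) / 64\<close>. A set of the family is \<^emph>\<open>short\<close> if it lies in
a progression with fewer than \<open>m + C\<close> elements, and \<^emph>\<open>long\<close> otherwise. To show that the long sets have
probability at least \<open>\<epsilon>\<close> it is enough that there are at least \<open>2 * \<epsilon>\<close> times as many of them as short
ones, so the size of the whole family need not be known. Both kinds are compared with the
\<open>k\<close>-subsets of \<open>{0..<m}\<close>, one copy for each progression in \<open>{1..n}\<close> of length about \<open>m\<close>.

\<^emph>\<open>Many long sets.\<close> Take a random \<open>(k - 1)\<close>-set in a block of length \<open>p = m - s\<close> and add one point at
distance \<open>t\<close> behind the block. The sums from the block number fewer than \<open>2 * p\<close>, and the new point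
adds only its double and its sums with the elements among the last \<open>t\<close> places of the block. There
are about \<open>2 * t / lam\<close> such elements, and, for a positive proportion of the sets, at most \<open>2 * s\<close> if
\<open>t = lam * s / 2\<close> (\<open>card_bodies_ge\<close>, \<open>stretch_props\<close>). So at most \<open>2 * m\<close> sums occur, while the length
is \<open>m + t - s\<close>, which is at least \<open>m + C\<close> for \<open>s\<close> of size \<open>4 * C / lam\<close>. Shortening the block by \<open>s\<close>
loses a factor \<open>exp (- 12 * s / lam)\<close> (\<open>choose_shrink\<close>), that is, about \<open>\<epsilon> powr (3 / 4)\<close>.

\<^emph>\<open>Few short sets.\<close> Counting all \<open>k\<close>-subsets of a progression of length \<open>m + J\<close>, with \<open>J\<close> of size \<open>C\<close>,
would exceed the count for length \<open>m\<close> by a factor exponential in \<open>J / lam\<close>, a power of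
\<open>1 / \<epsilon>\<close> that grows with \<open>lam\<close>. The bound on the sumset has to be used: it says that at least
\<open>2 * J - 1\<close> sums are missing. Sums far from both ends are hardly ever missing
(\<open>few_sets_miss_middle_sum\<close>). If \<open>i\<close> sums are missing near one end, then the set avoids about \<open>i / 2\<close>
points there, and these points are determined by very few elements of the set
(\<open>container_exists\<close>). Over both ends the set avoids about \<open>J\<close> points, so what remains is a
\<open>k\<close>-subset of a set of about \<open>m\<close> elements; the number of choices for the avoided points is
subexponential in \<open>J\<close>. Hence the factor is only \<open>exp (\<eta> * J)\<close> with \<open>\<eta>\<close> as small as desired
(\<open>few_sets_with_small_doubling\<close>), and \<open>\<eta> = 1 / lam\<^sup>2\<close> makes it a small power of \<open>1 / \<epsilon>\<close>.

Finally \<open>card_progs_comparison\<close> shows that there are at most a constant times as many progressions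
that can carry short sets as progressions of the length of the long sets; here it matters that \<open>n\<close>
exceeds \<open>m\<close> by a large constant.
\<close>

section \<open>Binomial coefficients and sets without given pairs\<close>

lemma choose_add_le:
  fixes k m j :: nat
  assumes "2 * k \<le> m"
  shows "(m + j) choose k \<le> 2 ^ j * (m choose k)"
proof (induction j)
  case (Suc j)
  have "(Suc (m + j) - k) * (Suc (m + j) choose k) = Suc (m + j) * ((m + j) choose k)"
    using binomial_absorb_comp[of "Suc (m + j)" k] by simp
  also have "\<dots> \<le> (2 * (Suc (m + j) - k)) * ((m + j) choose k)"
    using assms by (intro mult_right_mono) auto
  finally have "(Suc (m + j) - k) * (Suc (m + j) choose k)
      \<le> (Suc (m + j) - k) * (2 * ((m + j) choose k))"
    by (simp add: ac_simps)
  then have "Suc (m + j) choose k \<le> 2 * ((m + j) choose k)"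
    using assms by simp
  also have "\<dots> \<le> 2 * (2 ^ j * (m choose k))"
    using Suc by simp
  finally show ?case by simp
qed simp

lemma choose_add_ge:
  fixes q :: real and M K j :: nat
  assumes "q \<ge> 0" "real K \<le> (1 - q) * real M" "q \<le> 1"
  shows "q ^ j * real ((M + j) choose K) \<le> real (M choose K)"
proof (induction j)
  case (Suc j)
  have K: "real K \<le> (1 - q) * real (Suc (M + j))"
    using assms by (smt (verit) mult_left_mono of_nat_mono le_add1 le_SucI)
  have "(1 - q) * real (Suc (M + j)) \<le> 1 * real (Suc (M + j))"
    using assms by (intro mult_right_mono) auto
  then have "real K \<le> real (Suc (M + j))"
    using K by (simp only: mult_1)
  then have "K \<le> Suc (M + j)" by (simp only: of_nat_le_iff)
  then have "real ((Suc (M + j) - K) * (Suc (M + j) choose K))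
      = (real (Suc (M + j)) - real K) * real (Suc (M + j) choose K)"
    by (simp add: of_nat_diff)
  moreover have "(Suc (M + j) - K) * (Suc (M + j) choose K) = Suc (M + j) * ((M + j) choose K)"
    using binomial_absorb_comp[of "Suc (M + j)" K] by simp
  ultimately have eq: "(real (Suc (M + j)) - real K) * real (Suc (M + j) choose K)
      = real (Suc (M + j)) * real ((M + j) choose K)"
    by (metis of_nat_mult)
  have "real (Suc (M + j)) * (q * real (Suc (M + j) choose K))
     = (q * real (Suc (M + j))) * real (Suc (M + j) choose K)" by simp
  also have "\<dots> \<le> (real (Suc (M + j)) - real K) * real (Suc (M + j) choose K)"
    using K by (intro mult_right_mono) (auto simp: algebra_simps)
  finally have "real (Suc (M + j)) * (q * real (Suc (M + j) choose K))
      \<le> real (Suc (M + j)) * real ((M + j) choose K)"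
    using eq by simp
  then have "q * real (Suc (M + j) choose K) \<le> real ((M + j) choose K)"
    by (simp del: of_nat_Suc)
  then have "q ^ j * (q * real (Suc (M + j) choose K)) \<le> q ^ j * real ((M + j) choose K)"
    using assms by (intro mult_left_mono) auto
  then show ?case using Suc by (simp add: ac_simps)
qed simp

lemma choose_two_less:
  fixes M k :: nat
  assumes "2 \<le> k"  "2 \<le> M"
  shows "M * (M - 1) * ((M - 2) choose (k - 2)) = k * (k - 1) * (M choose k)"
proof -
  have "k * (k - 1) * (M choose k) = (k - 1) * (k * (M choose k))" by (simp only: mult_ac)
  also have "k * (M choose k) = M * ((M - 1) choose (k - 1))"
    using assms by (intro times_binomial_minus1_eq) auto
  also have "(k - 1) * (M * ((M - 1) choose (k - 1))) = M * ((k - 1) * ((M - 1) choose (k - 1)))"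
    by (simp only: mult_ac)
  also have "(k - 1) * ((M - 1) choose (k - 1)) = (M - 1) * ((M - 2) choose (k - 2))"
    using assms times_binomial_minus1_eq[of "k - 1" "M - 1"]
    by (simp add: numeral_2_eq_2)
  finally show ?thesis by (simp only: mult_ac)
qed

text \<open>
A random \<open>k\<close>-subset of \<open>X\<close> contains a given pair with probability about
\<open>(k / card X)\<^sup>2\<close>, and each of the disjoint forbidden pairs costs a factor \<open>1\<close> minus this. The induction
removes one pair at a time: deleting its two points turns Pascal's rule, applied twice, into
\<open>C(M,k) = C(M-2,k) + 2 C(M-2,k-1) + C(M-2,k-2)\<close>, and the last term counts exactly the subsets that
contain both points. Since \<open>k\<close> may drop at each of the \<open>h\<close> steps, the density \<open>\<kappa>\<close> is required to stay
below \<open>(k - h - 1) / card X\<close>.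
\<close>
lemma card_subsets_avoiding_pairs:
  fixes X :: "'a set" and f g :: "nat \<Rightarrow> 'a" and \<kappa> :: real
  assumes "finite X" "inj_on f {..<h}" "inj_on g {..<h}" "f ` {..<h} \<inter> g ` {..<h} = {}"
    "f ` {..<h} \<union> g ` {..<h} \<subseteq> X" "0 \<le> \<kappa>" "\<kappa> \<le> 1" "\<kappa> * real (card X) \<le> real k - real h - 1" "h + 1 \<le> k"
  shows "real (card {A. A \<subseteq> X \<and> card A = k \<and> (\<forall>i<h. \<not> (f i \<in> A \<and> g i \<in> A))})
      \<le> (1 - \<kappa>\<^sup>2) ^ h * real (card X choose k)"
  using assms
proof (induction h arbitrary: X k)
  case 0
  then show ?case by (simp add: n_subsets)
next
  case (Suc h)
  define X' where "X' = X - {f h, g h}"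
  define N where "N = (\<lambda>k. {A. A \<subseteq> X' \<and> card A = k \<and> (\<forall>i<h. \<not> (f i \<in> A \<and> g i \<in> A))})"
  have fg: "f h \<in> X" "g h \<in> X" "f h \<noteq> g h"
    using Suc.prems(4,5) by (auto simp: lessThan_Suc)
  have finX': "finite X'" using Suc.prems by (simp add: X'_def)
  have finN: "finite (N k)" for k
    by (rule finite_subset[of _ "Pow X'"]) (auto simp: N_def finX')
  have cX': "card X' = card X - 2"
    unfolding X'_def using fg Suc.prems(1) by (simp add: card_Diff_subset)
  have cX2: "2 \<le> card X"
    using card_mono[of X "{f h, g h}"] fg Suc.prems(1) by simp
  have k2: "2 \<le> k" using Suc.prems by simp
  have fg': "f i \<noteq> f h" "g i \<noteq> g h" "f i \<noteq> g h" "g i \<noteq> f h" if "i < h" for i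
  proof -
    show "f i \<noteq> f h" "g i \<noteq> g h"
      using that Suc.prems(2,3) by (auto simp: inj_on_def)
    show "f i \<noteq> g h" "g i \<noteq> f h"
      using that Suc.prems(4) by (force simp: lessThan_Suc)+
  qed
  have IH: "real (card (N k')) \<le> (1 - \<kappa>\<^sup>2) ^ h * real (card X' choose k')" if "k - 1 \<le> k'" for k'
    unfolding N_def
  proof (rule Suc.IH)
    show "finite X'" by fact
    show "inj_on f {..<h}" "inj_on g {..<h}"
      using Suc.prems(2,3) by (auto simp: inj_on_def)
    show "f ` {..<h} \<inter> g ` {..<h} = {}" using Suc.prems(4) by (auto simp: lessThan_Suc)
    show "f ` {..<h} \<union> g ` {..<h} \<subseteq> X'"
      using Suc.prems(5) fg' unfolding X'_def by (force simp: lessThan_Suc)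
    have "\<kappa> * real (card X') \<le> \<kappa> * real (card X)"
      unfolding cX' using Suc.prems(6) by (intro mult_left_mono) auto
    then show "\<kappa> * real (card X') \<le> real k' - real h - 1"
      using Suc.prems(8) that by linarith
    show "h + 1 \<le> k'" using Suc.prems that by linarith
  qed (use Suc.prems in auto)
  have "{A. A \<subseteq> X \<and> card A = k \<and> (\<forall>i<Suc h. \<not> (f i \<in> A \<and> g i \<in> A))}
      \<subseteq> N k \<union> insert (f h) ` N (k - 1) \<union> insert (g h) ` N (k - 1)" (is "?S \<subseteq> _")
  proof
    fix A assume A: "A \<in> ?S"
    then have finA: "finite A" using Suc.prems(1) finite_subset by auto
    have mem: "A - {x} \<in> N (k - 1) \<and> insert x (A - {x}) = A"
      if "x \<in> A" "x \<in> {f h, g h}" for x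
      using that A fg finA by (auto simp: N_def X'_def)
    consider "f h \<in> A" | "g h \<in> A" | "f h \<notin> A" "g h \<notin> A" by blast
    then show "A \<in> N k \<union> insert (f h) ` N (k - 1) \<union> insert (g h) ` N (k - 1)"
    proof cases
      case 1 then show ?thesis using mem[of "f h"] by (metis UnI1 UnI2 image_eqI insertI1)
    next
      case 2 then show ?thesis using mem[of "g h"] by (metis UnI2 image_eqI insertI1 insertI2)
    next
      case 3 then show ?thesis using A by (auto simp: N_def X'_def)
    qed
  qed
  then have "card ?S \<le> card (N k \<union> insert (f h) ` N (k - 1) \<union> insert (g h) ` N (k - 1))"
    by (intro card_mono) (auto simp: finN)
  also have "\<dots> \<le> card (N k) + card (insert (f h) ` N (k - 1)) + card (insert (g h) ` N (k - 1))"
    by (meson card_Un_le order.trans add_le_mono order_refl)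
  also have "\<dots> \<le> card (N k) + 2 * card (N (k - 1))"
    using card_image_le[OF finN, of "insert (f h)" "k - 1"] card_image_le[OF finN, of "insert (g h)" "k - 1"]
    by linarith
  finally have "real (card ?S) \<le> real (card (N k)) + 2 * real (card (N (k - 1)))"
    by linarith
  also have "\<dots> \<le> (1 - \<kappa>\<^sup>2) ^ h * (real (card X' choose k) + 2 * real (card X' choose (k - 1)))"
    using IH[of k] IH[of "k - 1"] by (simp add: algebra_simps)
  finally have bound: "real (card ?S)
      \<le> (1 - \<kappa>\<^sup>2) ^ h * (real (card X' choose k) + 2 * real (card X' choose (k - 1)))" .
  have "real (card X' choose k) + 2 * real (card X' choose (k - 1))
      = real (card X choose k) - real (card X' choose (k - 2))"
  proof -
    obtain M' k' where *: "card X = Suc (Suc M')" "k = Suc (Suc k')"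
      using cX2 k2 by (metis add_2_eq_Suc le_Suc_ex)
    show ?thesis unfolding cX' * by simp
  qed
  also have "\<dots> \<le> (1 - \<kappa>\<^sup>2) * real (card X choose k)"
  proof -
    define M where "M = card X"
    have kM: "\<kappa> * real M \<le> real k - 1"
      using Suc.prems(8) by (simp add: M_def)
    have M2: "2 \<le> M" using cX2 by (simp add: M_def)
    have "\<kappa>\<^sup>2 * (real M * (real M - 1)) \<le> \<kappa>\<^sup>2 * (real M * real M)"
      using M2 by (intro mult_left_mono) auto
    also have "\<dots> = (\<kappa> * real M) * (\<kappa> * real M)" by (simp add: power2_eq_square)
    also have "\<dots> \<le> real k * (real k - 1)"
      using kM Suc.prems(6) by (intro mult_mono) auto
    finally have le: "\<kappa>\<^sup>2 * (real M * (real M - 1)) \<le> real k * (real k - 1)" .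
    have "real (M * (M - 1) * ((M - 2) choose (k - 2))) = real (k * (k - 1) * (M choose k))"
      using choose_two_less[OF k2 M2] by simp
    then have "real M * (real M - 1) * real ((M - 2) choose (k - 2))
        = real k * (real k - 1) * real (M choose k)"
      using k2 M2 by (simp add: of_nat_diff)
    also have "\<dots> \<ge> \<kappa>\<^sup>2 * (real M * (real M - 1)) * real (M choose k)"
      using le by (intro mult_right_mono) auto
    finally have "(real M * (real M - 1)) * (\<kappa>\<^sup>2 * real (M choose k))
        \<le> (real M * (real M - 1)) * real ((M - 2) choose (k - 2))"
      by (simp add: ac_simps)
    moreover have "real M * (real M - 1) > 0" using M2 by simp
    ultimately have "\<kappa>\<^sup>2 * real (M choose k) \<le> real ((M - 2) choose (k - 2))"
      by (rule mult_left_le_imp_le)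
    then show ?thesis by (simp add: M_def cX' algebra_simps)
  qed
  finally have "(1 - \<kappa>\<^sup>2) ^ h * (real (card X' choose k) + 2 * real (card X' choose (k - 1)))
      \<le> (1 - \<kappa>\<^sup>2) ^ h * ((1 - \<kappa>\<^sup>2) * real (card X choose k))"
    using Suc.prems(6,7) by (intro mult_left_mono) (auto simp: power_le_one)
  with bound show ?case by (simp add: ac_simps)
qed

lemma choose_remove_one_le:
  assumes "1 \<le> k" "1 \<le> m" "real m \<le> lam * real k"
  shows "real (m choose k) \<le> lam * real ((m - 1) choose (k - 1))"
proof -
  have "k * (m choose k) = m * ((m - 1) choose (k - 1))"
    using assms by (intro times_binomial_minus1_eq) auto
  then have "real k * real (m choose k) = real m * real ((m - 1) choose (k - 1))"
    by (metis of_nat_mult)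
  also have "\<dots> \<le> (lam * real k) * real ((m - 1) choose (k - 1))"
    using assms by (intro mult_right_mono) auto
  finally have "real k * real (m choose k) \<le> real k * (lam * real ((m - 1) choose (k - 1)))"
    by (simp only: mult_ac)
  then show ?thesis using assms(1) by (simp only: mult_le_cancel_left_pos of_nat_0_less_iff)
qed

text \<open>
Shrinking the ground set of a random \<open>k\<close>-subset of density \<open>2 / lam\<close> by \<open>s\<close> points costs a factor
\<open>(1 - 2 / lam)\<close> per point, up to lower order. The weaker rate \<open>1 - 3 / lam \<ge> exp (- 12 / lam)\<close>
absorbs the lower order terms. The factor \<open>lam ^ 3\<close> pays for three elements of the subset that
are prescribed.
\<close>
lemma choose_shrink:
  fixes lam :: real
  assumes lam: "4 \<le> lam" and m: "real m = lam * real k / 2" and k: "4 \<le> k" and s: "1 \<le> s" "3 * s + 6 \<le> m"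
  shows "exp (- 12 * real s / lam) * real (m choose k) \<le> lam ^ 3 * real ((m - s - 2) choose (k - 3))"
proof -
  define q where "q = 1 - 3 / lam"
  have q: "0 \<le> q" "q \<le> 1" using lam by (auto simp: q_def)
  have lamk: "lam * 4 \<le> lam * real k" using lam k by (intro mult_left_mono) auto
  have q_ge: "exp (- 12 / lam) \<le> q"
  proof -
    have "36 / lam ^ 2 \<le> 9 / lam" using lam by (simp add: field_simps power2_eq_square)
    moreover have "q * (1 + 12 / lam) = 1 + 9 / lam - 36 / lam ^ 2"
      using lam by (simp add: q_def field_simps power2_eq_square)
    ultimately have "1 \<le> q * (1 + 12 / lam)" by linarith
    also have "\<dots> \<le> q * exp (12 / lam)" using q by (intro mult_left_mono exp_ge_add_one_self) auto
    finally have "exp (- (12 / lam)) * 1 \<le> exp (- (12 / lam)) * (q * exp (12 / lam))"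
      by (intro mult_left_mono) auto
    also have "\<dots> = q" by (simp add: exp_minus field_simps)
    finally show ?thesis by simp
  qed
  have "exp (- 12 * real s / lam) = exp (- 12 / lam) ^ s"
    by (simp add: exp_of_nat_mult[symmetric] mult.commute)
  also have "\<dots> \<le> q ^ s" using q_ge by (intro power_mono) auto
  also have "\<dots> \<le> q ^ (s - 1)" using q by (intro power_decreasing) auto
  finally have 1: "exp (- 12 * real s / lam) \<le> q ^ (s - 1)" .
  have 2: "real (m choose k) \<le> lam ^ 3 * real ((m - 3) choose (k - 3))"
  proof -
    have m': "real (m - 1) \<le> lam * real (k - 1)" "real (m - 2) \<le> lam * real (k - 2)"
      using lamk k s m by (simp_all add: of_nat_diff right_diff_distrib)
    have "real (m choose k) \<le> lam * real ((m - 1) choose (k - 1))"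
      using k s m lam by (intro choose_remove_one_le) auto
    moreover have "real ((m - 1) choose (k - 1)) \<le> lam * real ((m - 1 - 1) choose (k - 1 - 1))"
      using k s m'(1) by (intro choose_remove_one_le) auto
    moreover have "real ((m - 2) choose (k - 2)) \<le> lam * real ((m - 2 - 1) choose (k - 2 - 1))"
      using k s m'(2) by (intro choose_remove_one_le) auto
    moreover have "m - 1 - 1 = m - 2" "m - 2 - 1 = m - 3" "k - 1 - 1 = k - 2" "k - 2 - 1 = k - 3" by simp_all
    ultimately have c: "real (m choose k) \<le> lam * real ((m - 1) choose (k - 1))"
      "real ((m - 1) choose (k - 1)) \<le> lam * real ((m - 2) choose (k - 2))"
      "real ((m - 2) choose (k - 2)) \<le> lam * real ((m - 3) choose (k - 3))" by simp_all
    have "real (m choose k) \<le> lam * real ((m - 1) choose (k - 1))" by (rule c(1))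
    also have "\<dots> \<le> lam * (lam * real ((m - 2) choose (k - 2)))"
      using c(2) lam by (intro mult_left_mono) auto
    also have "\<dots> \<le> lam * (lam * (lam * real ((m - 3) choose (k - 3))))"
      using c(3) lam by (intro mult_left_mono) auto
    finally show ?thesis by (simp add: power3_eq_cube mult.assoc)
  qed
  have "real (k - 3) \<le> (1 - q) * real (m - s - 2)"
  proof -
    have "3 * real s + 6 \<le> real m" using s(2) by linarith
    then have "lam * (real k - 3) \<le> 3 * (real m - real s - 2)"
      using m lam by (simp add: algebra_simps)
    then show ?thesis using lam k s by (simp add: q_def of_nat_diff field_simps)
  qed
  moreover have "m - s - 2 + (s - 1) = m - 3" using s by simp
  ultimately have 3: "q ^ (s - 1) * real ((m - 3) choose (k - 3)) \<le> real ((m - s - 2) choose (k - 3))"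
    using choose_add_ge[OF q(1) _ q(2), of "k - 3" "m - s - 2" "s - 1"] by (simp only:)
  have "exp (- 12 * real s / lam) * real (m choose k)
      \<le> q ^ (s - 1) * (lam ^ 3 * real ((m - 3) choose (k - 3)))"
    using 1 2 q by (intro mult_mono) auto
  also have "\<dots> = lam ^ 3 * (q ^ (s - 1) * real ((m - 3) choose (k - 3)))" by (simp only: mult_ac)
  also have "\<dots> \<le> lam ^ 3 * real ((m - s - 2) choose (k - 3))"
    using 3 lam by (intro mult_left_mono) auto
  finally show ?thesis .
qed

section \<open>Sums far from both ends\<close>

text \<open>
If \<open>z\<close> is not a sum, then \<open>A\<close> contains none of the disjoint pairs \<open>{x, z - x}\<close> inside \<open>{0..<L}\<close>.
\<close>
lemma card_sets_missing_sum:
  fixes L k h z :: nat and \<kappa> :: real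
  assumes "2 * h \<le> z" "2 * h + z \<le> 2 * L - 2" "1 \<le> L"
    and \<kappa>: "0 \<le> \<kappa>" "\<kappa> \<le> 1" "\<kappa> * real L \<le> real k - real h - 1" "h + 1 \<le> k"
  shows "real (card {A. A \<subseteq> {0..<int L} \<and> card A = k \<and> int z \<notin> A + A})
      \<le> (1 - \<kappa>\<^sup>2) ^ h * real (L choose k)"
proof -
  \<comment> \<open>The smallest \<open>x\<close> for which both \<open>x\<close> and \<open>z - x\<close> lie in \<open>{0..<L}\<close>; the pairs are
    counted upwards from it.\<close>
  define b where "b = max 0 (int z - (int L - 1))"
  define f where "f = (\<lambda>i::nat. b + int i)"
  define g where "g = (\<lambda>i::nat. int z - b - int i)"
  have b: "0 \<le> b" "int z - b < int L" "2 * (b + int h) \<le> int z" "b + int h \<le> int L" "int h \<le> int z - b"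
    using assms(1-3) unfolding b_def max_def by (simp_all split: if_split) linarith+
  have "{A. A \<subseteq> {0..<int L} \<and> card A = k \<and> int z \<notin> A + A}
      \<subseteq> {A. A \<subseteq> {0..<int L} \<and> card A = k \<and> (\<forall>i<h. \<not> (f i \<in> A \<and> g i \<in> A))}" (is "?S \<subseteq> ?T")
  proof
    fix A assume A: "A \<in> ?S"
    have "\<not> (f i \<in> A \<and> g i \<in> A)" for i
      using A set_plus_intro[of "f i" A "g i" A] by (auto simp: f_def g_def)
    then show "A \<in> ?T" using A by blast
  qed
  moreover have "finite ?T" by (rule finite_subset[of _ "Pow {0..<int L}"]) auto
  ultimately have "real (card ?S) \<le> real (card ?T)" by (intro of_nat_mono card_mono)
  also have "\<dots> \<le> (1 - \<kappa>\<^sup>2) ^ h * real (card {0..<int L} choose k)"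
  proof (rule card_subsets_avoiding_pairs)
    show "inj_on f {..<h}" "inj_on g {..<h}" by (auto simp: f_def g_def inj_on_def)
    show "f ` {..<h} \<inter> g ` {..<h} = {}" using b by (auto simp: f_def g_def)
    show "f ` {..<h} \<union> g ` {..<h} \<subseteq> {0..<int L}" using b by (auto simp: f_def g_def)
  qed (use \<kappa> in auto)
  finally show ?thesis by simp
qed

text \<open>
The probability that \<open>z\<close> is not a sum decays exponentially in the distance of \<open>z\<close> from the two ends
of \<open>{0..2 * L - 2}\<close>. Summing a geometric series over the sums at distance at least \<open>B * v\<^sup>2\<close> and
taking \<open>B\<close> large gives any exponential gain in \<open>v\<^sup>2\<close>; a gain of \<open>2\<close> per unit pays for the
factor lost in \<open>choose_add_le\<close>, with constants that depend on \<open>\<Lambda>\<close> alone.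
\<close>
lemma few_sets_miss_middle_sum:
  fixes \<Lambda> :: nat
  assumes \<Lambda>: "1 \<le> \<Lambda>"
  shows "\<exists>B v0. 1 \<le> B \<and> (\<forall>v\<ge>v0. \<forall>L k. 4 \<le> k \<and> 1 \<le> L \<and> L \<le> \<Lambda> * k \<longrightarrow>
    2 ^ v\<^sup>2 * card {A. A \<subseteq> {0..<int L} \<and> card A = k \<and>
        (\<exists>z\<in>{B * v\<^sup>2..2 * L - 2 - B * v\<^sup>2}. int z \<notin> A + A)} \<le> (L choose k))"
proof -
  define \<kappa> :: real where "\<kappa> = 1 / (4 * \<Lambda>)"
  define q where "q = 2 * \<Lambda>"
  \<comment> \<open>At distance \<open>z'\<close> from an end only \<open>z' div q\<close> pairs are used, so that fewer than
    half of the elements of \<open>A\<close> are consumed. By Bernoulli's inequality \<open>\<sigma>\<close> is a decay rate per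
    unit of distance.\<close>
  define \<sigma> where "\<sigma> = 1 - \<kappa>\<^sup>2 / q"
  have q: "1 \<le> q" using \<Lambda> by (simp add: q_def)
  have \<kappa>: "0 < \<kappa>" "\<kappa> \<le> 1" using \<Lambda> by (auto simp: \<kappa>_def)
  have "\<kappa>\<^sup>2 \<le> 1" using \<kappa> by (simp add: power_le_one)
  have "\<kappa>\<^sup>2 / q \<le> \<kappa>\<^sup>2 / 2" using \<Lambda> by (intro divide_left_mono) (auto simp: q_def)
  moreover have "0 < \<kappa>\<^sup>2 / q" using \<kappa> q by simp
  ultimately have \<sigma>: "0 < \<sigma>" "\<sigma> < 1"
    using \<open>\<kappa>\<^sup>2 \<le> 1\<close> unfolding \<sigma>_def by linarith+
  have \<rho>\<sigma>: "1 - \<kappa>\<^sup>2 \<le> \<sigma> ^ q"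
  proof -
    have "1 + real q * (- (\<kappa>\<^sup>2 / q)) \<le> (1 + - (\<kappa>\<^sup>2 / q)) ^ q"
      using \<sigma> by (intro Bernoulli_inequality) (auto simp: \<sigma>_def)
    then show ?thesis using q by (simp add: \<sigma>_def)
  qed
  obtain B0 where B0: "\<sigma> ^ B0 < 1 / 4"
    using real_arch_pow_inv[of "1/4" \<sigma>] \<sigma> by auto
  define B where "B = Suc B0"
  have B: "\<sigma> ^ B \<le> 1 / 4" "1 \<le> B"
  proof -
    have "\<sigma> ^ B \<le> \<sigma> ^ B0" using \<sigma> by (intro power_decreasing) (auto simp: B_def)
    then show "\<sigma> ^ B \<le> 1 / 4" using B0 by linarith
  qed (simp add: B_def)
  obtain v1 where v1: "2 / (\<sigma> ^ q * (1 - \<sigma>)) < 2 ^ v1"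
    using real_arch_pow[of 2 "2 / (\<sigma> ^ q * (1 - \<sigma>))"] by auto
  have main: "2 ^ v\<^sup>2 * card {A. A \<subseteq> {0..<int L} \<and> card A = k \<and>
        (\<exists>z\<in>{B * v\<^sup>2..2 * L - 2 - B * v\<^sup>2}. int z \<notin> A + A)} \<le> (L choose k)"
    if v: "Suc v1 \<le> v" and k: "4 \<le> k" and L: "1 \<le> L" "L \<le> \<Lambda> * k" for v L k
  proof -
    define D where "D = B * v\<^sup>2"
    define I where "I = {D..2 * L - 2 - D}"
    define E where "E = (\<lambda>z. {A. A \<subseteq> {0..<int L} \<and> card A = k \<and> int z \<notin> A + A})"
    define C where "C = real (L choose k)"
    have C0: "0 \<le> C" by (simp add: C_def)
    have single: "\<sigma> ^ q * real (card (E z)) \<le> (\<sigma> ^ z + \<sigma> ^ (2 * L - 2 - z)) * C" if "z \<in> I" for z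
    proof -
      define z' where "z' = min z (2 * L - 2 - z)"
      define h where "h = z' div q"
      have "z' \<le> L - 1" by (auto simp: z'_def)
      then have "z' < \<Lambda> * k" using L by linarith
      then have hk: "2 * h < k"
      proof -
        have "h * q \<le> z'" by (simp add: h_def)
        then have "\<Lambda> * (2 * h) \<le> z'" by (simp add: q_def ac_simps)
        then have "\<Lambda> * (2 * h) < \<Lambda> * k" using \<open>z' < \<Lambda> * k\<close> by (rule le_less_trans)
        then show ?thesis by (simp only: mult_less_cancel1)
      qed
      have "2 * h \<le> q * h" using \<Lambda> by (simp add: q_def)
      also have "\<dots> \<le> z'" by (simp add: h_def)
      finally have hz: "2 * h \<le> z'" .
      have "\<kappa> * real L \<le> \<kappa> * real (\<Lambda> * k)" using L \<kappa> by (intro mult_left_mono) (auto simp del: of_nat_mult)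
      also have "\<dots> = real k / 4" using \<Lambda> by (simp add: \<kappa>_def)
      also have "\<dots> \<le> real k - real h - 1" using hk k by linarith
      finally have \<kappa>L: "\<kappa> * real L \<le> real k - real h - 1" .
      have "real (card (E z)) \<le> (1 - \<kappa>\<^sup>2) ^ h * C"
        unfolding E_def C_def
        using hz \<kappa> \<kappa>L hk k L that by (intro card_sets_missing_sum) (auto simp: z'_def I_def)
      also have "\<dots> \<le> (\<sigma> ^ q) ^ h * C"
        using \<rho>\<sigma> \<open>\<kappa>\<^sup>2 \<le> 1\<close> C0 by (intro mult_right_mono power_mono) auto
      finally have "\<sigma> ^ q * real (card (E z)) \<le> \<sigma> ^ q * ((\<sigma> ^ q) ^ h * C)"
        using \<sigma> by (intro mult_left_mono) auto
      also have "\<dots> = \<sigma> ^ (q + q * h) * C" by (simp add: power_add power_mult)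
      also have "\<dots> \<le> \<sigma> ^ z' * C"
      proof -
        have "z' = q * h + z' mod q" by (simp add: h_def)
        moreover have "z' mod q < q" using q by simp
        ultimately have "z' \<le> q + q * h" by linarith
        then show ?thesis using \<sigma> C0 by (intro mult_right_mono power_decreasing) auto
      qed
      also have "\<dots> \<le> (\<sigma> ^ z + \<sigma> ^ (2 * L - 2 - z)) * C"
        using \<sigma> C0 by (intro mult_right_mono) (auto simp: z'_def min_def)
      finally show ?thesis .
    qed
    have rev: "(\<Sum>z\<in>I. \<sigma> ^ (2 * L - 2 - z)) = (\<Sum>z\<in>I. \<sigma> ^ z)"
      by (rule sum.reindex_bij_witness[where i = "\<lambda>z. 2 * L - 2 - z" and j = "\<lambda>z. 2 * L - 2 - z"])
         (auto simp: I_def)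
    have geo: "(\<Sum>z\<in>I. \<sigma> ^ z) \<le> \<sigma> ^ D / (1 - \<sigma>)"
    proof -
      have "(\<Sum>z\<in>I. \<sigma> ^ z) \<le> (\<Sum>z\<in>{D..<D + Suc (2 * L)}. \<sigma> ^ z)"
        using \<sigma> by (intro sum_mono2) (auto simp: I_def)
      also have "\<dots> = (\<Sum>i<Suc (2 * L). \<sigma> ^ (i + D))"
        by (rule sum.reindex_bij_witness[where i = "\<lambda>i. i + D" and j = "\<lambda>z. z - D"]) auto
      also have "\<dots> = \<sigma> ^ D * (\<Sum>i<Suc (2 * L). \<sigma> ^ i)"
        by (simp only: power_add sum_distrib_left mult.commute)
      also have "(\<Sum>i<Suc (2 * L). \<sigma> ^ i) = (1 - \<sigma> ^ Suc (2 * L)) / (1 - \<sigma>)"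
        using \<sigma> by (subst sum_gp_strict) auto
      also have "\<sigma> ^ D * \<dots> \<le> \<sigma> ^ D * (1 / (1 - \<sigma>))"
        using \<sigma> by (intro mult_left_mono divide_right_mono) auto
      finally show ?thesis by simp
    qed
    let ?M = "{A. A \<subseteq> {0..<int L} \<and> card A = k \<and> (\<exists>z\<in>I. int z \<notin> A + A)}"
    have "?M = (\<Union>z\<in>I. E z)" by (auto simp: E_def)
    then have "card ?M \<le> (\<Sum>z\<in>I. card (E z))"
      using card_UN_le[of I E] by (simp add: I_def)
    then have "real (card ?M) \<le> (\<Sum>z\<in>I. real (card (E z)))"
      by (simp only: of_nat_sum[symmetric] of_nat_le_iff)
    then have "\<sigma> ^ q * real (card ?M) \<le> \<sigma> ^ q * (\<Sum>z\<in>I. real (card (E z)))"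
      using \<sigma> by (intro mult_left_mono) auto
    also have "\<dots> \<le> (\<Sum>z\<in>I. (\<sigma> ^ z + \<sigma> ^ (2 * L - 2 - z)) * C)"
      unfolding sum_distrib_left using single by (rule sum_mono)
    also have "\<dots> = 2 * (\<Sum>z\<in>I. \<sigma> ^ z) * C"
      unfolding sum_distrib_right[symmetric] sum.distrib rev by simp
    also have "\<dots> \<le> 2 * (\<sigma> ^ D / (1 - \<sigma>)) * C"
      using geo C0 by (intro mult_right_mono mult_left_mono) auto
    finally have "\<sigma> ^ q * real (card ?M) \<le> 2 * (\<sigma> ^ D / (1 - \<sigma>)) * C" .
    then have "real (card ?M) \<le> (2 / (\<sigma> ^ q * (1 - \<sigma>))) * \<sigma> ^ D * C"
      using \<sigma> by (simp add: field_simps)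
    also have "\<dots> \<le> 2 ^ v\<^sup>2 * (1 / 4) ^ v\<^sup>2 * C"
    proof (intro mult_right_mono mult_mono)
      have "v1 \<le> v\<^sup>2" using v by (simp add: power2_eq_square) (metis Suc_leD le_square order.trans)
      then have "(2::real) ^ v1 \<le> 2 ^ v\<^sup>2" by (intro power_increasing) auto
      then show "2 / (\<sigma> ^ q * (1 - \<sigma>)) \<le> 2 ^ v\<^sup>2" using v1 by linarith
      show "\<sigma> ^ D \<le> (1 / 4) ^ v\<^sup>2"
        unfolding D_def power_mult using B \<sigma> by (intro power_mono) auto
    qed (use \<sigma> C0 in auto)
    finally have "2 ^ v\<^sup>2 * real (card ?M) \<le> 2 ^ v\<^sup>2 * (2 ^ v\<^sup>2 * (1 / 4) ^ v\<^sup>2 * C)"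
      by (intro mult_left_mono) auto
    also have "\<dots> = (2 * 2 * (1 / 4)) ^ v\<^sup>2 * C" by (simp only: power_mult_distrib mult_ac)
    also have "\<dots> = real (L choose k)" by (simp add: C_def)
    finally have "real (2 ^ v\<^sup>2 * card ?M) \<le> real (L choose k)" by simp
    then show ?thesis unfolding of_nat_le_iff I_def D_def .
  qed
  show ?thesis using B(2) main by blast
qed

section \<open>Containers for sets with missing sums\<close>

text \<open>
Think of \<open>R\<close> as the part of \<open>A\<close> below \<open>u\<close> and of \<open>F\<close> as a few elements of \<open>A\<close> in \<open>{u..<D}\<close>: then
the sums below \<open>D\<close> that \<open>A\<close> misses lie below \<open>2 * u\<close> or are uncovered.
\<close>
definition uncovered :: "int \<Rightarrow> int \<Rightarrow> int set \<Rightarrow> int set \<Rightarrow> int set" where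
  "uncovered D u R F = {2 * u..<D} - (R + F)"

text \<open>
A set of points that \<open>A\<close> has to avoid, computed from \<open>u\<close>, \<open>R\<close> and \<open>F\<close> alone: the gaps of \<open>A\<close>
below \<open>u\<close>, and the points \<open>y\<close> whose translate \<open>y + R\<close> meets the uncovered set in at least \<open>w\<close> points.
\<close>
definition gap_container :: "int \<Rightarrow> nat \<Rightarrow> int \<Rightarrow> int set \<Rightarrow> int set \<Rightarrow> int set" where
  "gap_container D w u R F =
     ({0..<u} - R) \<union> {y \<in> {u..<D}. w \<le> card {x \<in> R. y + x \<in> uncovered D u R F}}"

lemma finite_uncovered: "finite (uncovered D u R F)"
  by (simp add: uncovered_def)

text \<open>
A version of the container method. Let \<open>R\<close> consist of the first \<open>r\<close> elements of \<open>A\<close>, and \<open>u\<close> be the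
position up to which they extend. Elements of \<open>A\<close> above \<open>u\<close> are added to \<open>F\<close> greedily, as long as
they reduce the uncovered set by at least \<open>w\<close> points each; this stops after at most \<open>D / w\<close> steps,
and then \<open>A\<close> contains no point \<open>y\<close> of degree at least \<open>w\<close>. Counting the pairs of a point of \<open>R\<close> and
an uncovered point shows that there are at least as many points of high degree as uncovered points,
up to \<open>D * w / r\<close>. Hence, up to \<open>r\<close> and \<open>e\<close>, a set with \<open>i\<close> missing sums below \<open>D\<close> avoids \<open>u\<close>
points below \<open>u\<close> and \<open>i - 2 * u\<close> points above, which is at least \<open>i / 2\<close> in every case (if
\<open>i \<le> 2 * u\<close>, the first part suffices).
\<close>
lemma container_exists:
  fixes A :: "int set" and D :: int and r w e :: nat
  assumes A: "A \<subseteq> {0..}" and D: "0 \<le> D" and w: "1 \<le> w" and r: "1 \<le> r" and Dw: "nat D * w \<le> r * e"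
  obtains u R F where "u \<in> {0..D}" "R \<subseteq> {0..<D}" "F \<subseteq> {0..<D}" "card R \<le> r" "card F * w \<le> nat D"
    "A \<inter> gap_container D w u R F = {}" "gap_container D w u R F \<subseteq> {0..<D}"
    "card ({0..<D} - (A + A)) \<le> 2 * card (gap_container D w u R F) + 2 * r + 2 * e"
proof -
  define S where "S = {u \<in> {0..D}. card (A \<inter> {0..<u}) \<le> r}"
  have finS: "finite S" by (rule finite_subset[of _ "{0..D}"]) (auto simp: S_def)
  have "0 \<in> S" using D by (simp add: S_def)
  define u where "u = Max S"
  have uS: "u \<in> S" unfolding u_def using finS \<open>0 \<in> S\<close> by (intro Max_in) auto
  define R where "R = A \<inter> {0..<u}"
  have u: "0 \<le> u" "u \<le> D" and cR: "card R \<le> r" using uS by (auto simp: S_def R_def)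
  have finR: "finite R" by (simp add: R_def)
  \<comment> \<open>If \<open>u = D\<close>, the set \<open>R\<close> may be smaller, but then no sum is uncovered.\<close>
  have cR_eq: "card R = r" if "u < D"
  proof (rule ccontr)
    assume "card R \<noteq> r"
    then have "card R + 1 \<le> r" using cR by simp
    moreover have "A \<inter> {0..<u + 1} \<subseteq> insert u R" using u by (auto simp: R_def)
    then have "card (A \<inter> {0..<u + 1}) \<le> card (insert u R)"
      using finR by (intro card_mono) auto
    moreover have "card (insert u R) \<le> card R + 1"
      using finR by (simp add: card_insert_if)
    ultimately have "u + 1 \<in> S" using that u by (simp add: S_def)
    then have "u + 1 \<le> u" unfolding u_def using finS by (intro Max_ge)
    then show False by simp
  qed
  define W where "W = uncovered D u R"
  have finW: "finite (W F)" for F by (simp add: W_def finite_uncovered)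
  define \<F> where "\<F> = {F. F \<subseteq> A \<inter> {u..<D} \<and> card (W F) + w * card F \<le> card (W {})}"
  have fin\<F>: "finite \<F>"
    by (rule finite_subset[of _ "Pow (A \<inter> {u..<D})"]) (auto simp: \<F>_def)
  have "{} \<in> \<F>" by (simp add: \<F>_def)
  \<comment> \<open>A set \<open>F\<close> of maximal size in \<open>\<F>\<close> is a terminal state of the greedy choice.\<close>
  define c where "c = Max (card ` \<F>)"
  have "c \<in> card ` \<F>" unfolding c_def using fin\<F> \<open>{} \<in> \<F>\<close> by (intro Max_in) auto
  then obtain F where F: "F \<in> \<F>" and cF: "card F = c" by blast
  have maxF: "card F' \<le> card F" if "F' \<in> \<F>" for F'
    unfolding cF c_def using fin\<F> that by (intro Max_ge) auto
  have FA: "F \<subseteq> A \<inter> {u..<D}" using F by (simp add: \<F>_def)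
  then have finF: "finite F" by (rule finite_subset) simp
  define deg where "deg = (\<lambda>y. card {x \<in> R. y + x \<in> W F})"
  define Hi where "Hi = {y \<in> {u..<D}. w \<le> deg y}"
  have Y: "gap_container D w u R F = ({0..<u} - R) \<union> Hi"
    by (simp add: gap_container_def Hi_def deg_def W_def)
  have finHi: "finite Hi" by (rule finite_subset[of _ "{u..<D}"]) (auto simp: Hi_def)
  have disj_Hi: "y \<notin> Hi" if "y \<in> A" for y
  proof
    assume y: "y \<in> Hi"
    have "y \<notin> F"
    proof
      assume "y \<in> F"
      then have "{x \<in> R. y + x \<in> W F} = {}"
        by (auto simp: W_def uncovered_def set_plus_def add.commute)
      then have "deg y = 0" by (simp only: deg_def card.empty)
      then show False using y w by (simp add: Hi_def)
    qed
    have sub: "W (insert y F) \<subseteq> W F - (\<lambda>x. y + x) ` {x \<in> R. y + x \<in> W F}"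
      by (auto simp: W_def uncovered_def set_plus_def)
    have im: "(\<lambda>x. y + x) ` {x \<in> R. y + x \<in> W F} \<subseteq> W F" by auto
    have cim: "card ((\<lambda>x. y + x) ` {x \<in> R. y + x \<in> W F}) = deg y"
      unfolding deg_def by (rule card_image) (simp add: inj_on_def)
    have "card (W (insert y F)) \<le> card (W F - (\<lambda>x. y + x) ` {x \<in> R. y + x \<in> W F})"
      using finW sub by (intro card_mono) auto
    also have "\<dots> = card (W F) - deg y"
      using card_Diff_subset[OF finite_subset[OF im finW] im] cim by simp
    finally have "card (W (insert y F)) + deg y \<le> card (W F)"
      using card_mono[OF finW im] cim by simp
    then have "card (W (insert y F)) + w * card (insert y F) \<le> card (W {})"
      using y \<open>y \<notin> F\<close> finF F by (simp add: Hi_def \<F>_def)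
    then have "insert y F \<in> \<F>"
      using FA that y by (simp add: \<F>_def Hi_def)
    from maxF[OF this] show False using \<open>y \<notin> F\<close> finF by simp
  qed
  show thesis
  proof (rule that)
    show "u \<in> {0..D}" using u by simp
    show "R \<subseteq> {0..<D}" using u by (auto simp: R_def)
    show "F \<subseteq> {0..<D}" using FA u by auto
    show "card R \<le> r" by fact
    have "W {} \<subseteq> {0..<D}" using u by (auto simp: W_def uncovered_def)
    then have "card (W {}) \<le> card {0..<D}" by (intro card_mono) auto
    then show "card F * w \<le> nat D" using F by (simp add: \<F>_def mult.commute)
    show "gap_container D w u R F \<subseteq> {0..<D}" unfolding Y using u by (auto simp: Hi_def)
    show "A \<inter> gap_container D w u R F = {}"
      unfolding Y using disj_Hi by (auto simp: R_def)
    have WHi: "card (W F) \<le> card Hi + e"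
    proof (cases "W F = {}")
      case False
      then have "u < D" using u by (auto simp: W_def uncovered_def)
      then have cRr: "card R = r" by (rule cR_eq)
      have "card (W F) * r = card (W F \<times> R)" by (simp add: card_cartesian_product cRr)
      also have "\<dots> \<le> card (SIGMA y:{u..<D}. {x \<in> R. y + x \<in> W F})"
      proof (rule card_inj_on_le[where f = "\<lambda>(z, x). (z - x, x)"])
        show "inj_on (\<lambda>(z, x). (z - x, x)) (W F \<times> R)" by (auto simp: inj_on_def)
        show "(\<lambda>(z, x). (z - x, x)) ` (W F \<times> R) \<subseteq> (SIGMA y:{u..<D}. {x \<in> R. y + x \<in> W F})"
          by (auto simp: R_def W_def uncovered_def)
        show "finite (SIGMA y:{u..<D}. {x \<in> R. y + x \<in> W F})"
          using finR by (intro finite_SigmaI) auto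
      qed
      also have "\<dots> = (\<Sum>y\<in>{u..<D}. deg y)"
        using finR by (subst card_SigmaI) (auto simp: deg_def)
      also have "\<dots> \<le> (\<Sum>y\<in>{u..<D}. (if y \<in> Hi then r else 0) + w)"
      proof (rule sum_mono)
        fix y assume y: "y \<in> {u..<D}"
        have "deg y \<le> card R" unfolding deg_def using finR by (intro card_mono) auto
        then show "deg y \<le> (if y \<in> Hi then r else 0) + w"
          using y cRr by (auto simp: Hi_def)
      qed
      also have "\<dots> = r * card Hi + w * card {u..<D}"
      proof -
        have "{u..<D} \<inter> {y. y \<in> Hi} = Hi" by (auto simp: Hi_def)
        then show ?thesis by (simp add: sum.distrib sum.If_cases mult.commute)
      qed
      also have "w * card {u..<D} \<le> nat D * w" using u by (simp add: nat_mono)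
      also have "\<dots> \<le> r * e" by (rule Dw)
      finally have "r * card (W F) \<le> r * (card Hi + e)" by (simp add: algebra_simps)
      then show ?thesis using r by simp
    qed simp
    have "{0..<D} - (A + A) \<subseteq> {0..<2 * u} \<union> W F"
    proof
      fix z assume z: "z \<in> {0..<D} - (A + A)"
      have "R + F \<subseteq> A + A" using FA by (intro set_plus_mono2) (auto simp: R_def)
      then show "z \<in> {0..<2 * u} \<union> W F" using z by (auto simp: W_def uncovered_def)
    qed
    then have "card ({0..<D} - (A + A)) \<le> card ({0..<2 * u} \<union> W F)"
      using finW by (intro card_mono) auto
    also have "\<dots> \<le> card {0..<2 * u} + card (W F)" by (rule card_Un_le)
    also have "card {0..<2 * u} = 2 * nat u" using u by simp
    finally have Z: "card ({0..<D} - (A + A)) \<le> 2 * nat u + card (W F)" by simp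
    have "card (gap_container D w u R F) = card ({0..<u} - R) + card Hi"
      unfolding Y using finHi by (subst card_Un_disjoint) (auto simp: Hi_def)
    moreover have "card ({0..<u} - R) = nat u - card R"
      using finR by (subst card_Diff_subset) (auto simp: R_def)
    ultimately show "card ({0..<D} - (A + A)) \<le> 2 * card (gap_container D w u R F) + 2 * r + 2 * e"
      using Z WHi cR by linarith
  qed
qed

section \<open>Counting sets with few sums in an interval\<close>

lemma card_small_subsets_le:
  assumes "finite X"
  shows "card {R. R \<subseteq> X \<and> card R \<le> r} \<le> (card X + 1) ^ r"
proof (induction r)
  case 0
  have "{R. R \<subseteq> X \<and> card R \<le> 0} \<subseteq> {{}}" using assms by (auto dest: finite_subset)
  then have "card {R. R \<subseteq> X \<and> card R \<le> 0} \<le> card {{}::'a set}" by (intro card_mono) auto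
  then show ?case by simp
next
  case (Suc r)
  define S where "S = (\<lambda>r. {R. R \<subseteq> X \<and> card R \<le> r})"
  have finS: "finite (S r)" for r
    by (rule finite_subset[of _ "Pow X"]) (auto simp: S_def assms)
  have "S (Suc r) \<subseteq> S r \<union> (\<lambda>(x, R). insert x R) ` (X \<times> S r)"
  proof
    fix R assume R: "R \<in> S (Suc r)"
    then have finR: "finite R" using assms finite_subset by (auto simp: S_def)
    show "R \<in> S r \<union> (\<lambda>(x, R). insert x R) ` (X \<times> S r)"
    proof (cases "R = {}")
      case False
      then obtain x where x: "x \<in> R" by blast
      then have "(x, R - {x}) \<in> X \<times> S r" "R = insert x (R - {x})"
        using R finR by (auto simp: S_def)
      then have "R \<in> (\<lambda>(x, R). insert x R) ` (X \<times> S r)"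
        by (intro image_eqI[of _ _ "(x, R - {x})"]) auto
      then show ?thesis by blast
    qed (simp add: S_def)
  qed
  then have "card (S (Suc r)) \<le> card (S r \<union> (\<lambda>(x, R). insert x R) ` (X \<times> S r))"
    using finS assms by (intro card_mono) auto
  also have "\<dots> \<le> card (S r) + card ((\<lambda>(x, R). insert x R) ` (X \<times> S r))" by (rule card_Un_le)
  also have "\<dots> \<le> card (S r) + card X * card (S r)"
    using card_image_le[of "X \<times> S r" "\<lambda>(x, R). insert x R"] finS assms
    by (simp add: card_cartesian_product)
  also have "\<dots> = (card X + 1) * card (S r)" by simp
  also have "\<dots> \<le> (card X + 1) * (card X + 1) ^ r"
    using Suc by (intro mult_left_mono) (auto simp: S_def)
  finally show ?case by (simp add: S_def)
qed

lemma reflect_sumset: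
  fixes A :: "int set"
  shows "(\<lambda>x. c - x) ` A + (\<lambda>x. c - x) ` A = (\<lambda>z. 2 * c - z) ` (A + A)"
proof (intro set_eqI iffI)
  fix z assume "z \<in> (\<lambda>x. c - x) ` A + (\<lambda>x. c - x) ` A"
  then obtain x y where "x \<in> A" "y \<in> A" "z = 2 * c - (x + y)" by (auto simp: set_plus_def)
  then show "z \<in> (\<lambda>z. 2 * c - z) ` (A + A)" by blast
next
  fix z assume "z \<in> (\<lambda>z. 2 * c - z) ` (A + A)"
  then obtain x y where "x \<in> A" "y \<in> A" "z = (c - x) + (c - y)" by (auto simp: set_plus_def)
  then show "z \<in> (\<lambda>x. c - x) ` A + (\<lambda>x. c - x) ` A" by blast
qed

text \<open>
A set \<open>A\<close> in \<open>{0..<m + J}\<close> with at most \<open>2 * m\<close> sums misses at least \<open>2 * J - 1\<close> of the \<open>2 * L - 1\<close>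
possible ones. Either it misses one in the middle, or all missing sums are within \<open>D\<close> of one of the
two ends. In the second case \<open>container_exists\<close>, applied to \<open>A\<close> and to its reflection, gives two
disjoint sets that \<open>A\<close> avoids, with together at least \<open>J - 2 * r - 2 * e\<close> elements, and this pair of
sets has few possible values. So \<open>A\<close> is a \<open>k\<close>-subset of a set of at most \<open>m + 2 * r + 2 * e\<close>
elements: the excess \<open>J\<close> is lost almost entirely.
\<close>
lemma card_small_doubling_le:
  fixes m k J D w r e :: nat
  defines "L \<equiv> m + J"
  assumes w: "1 \<le> w" and r: "1 \<le> r" and Dw: "D * w \<le> r * e" and km: "2 * k \<le> m" and DL: "2 * D \<le> L" and L1: "1 \<le> L"
  shows "card {A. A \<subseteq> {0..<int L} \<and> card A = k \<and> card (A + A) \<le> 2 * m}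
    \<le> card {A. A \<subseteq> {0..<int L} \<and> card A = k \<and> (\<exists>z\<in>{D..2 * L - 2 - D}. int z \<notin> A + A)}
      + ((D + 1) ^ (1 + r + D div w))\<^sup>2 * 2 ^ (2 * r + 2 * e) * (m choose k)"
proof -
  let ?S = "{A. A \<subseteq> {0..<int L} \<and> card A = k \<and> card (A + A) \<le> 2 * m}"
  let ?M = "{A. A \<subseteq> {0..<int L} \<and> card A = k \<and> (\<exists>z\<in>{D..2 * L - 2 - D}. int z \<notin> A + A)}"
  define refl where "refl = (\<lambda>A. (\<lambda>x. int L - 1 - x) ` A)"
  have card_refl: "card (refl A) = card A" for A
    unfolding refl_def by (rule card_image) (simp add: inj_on_def)
  have refl_sub: "refl A \<subseteq> {0..<int L}" if "A \<subseteq> {0..<int L}" for A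
    using that by (auto simp: refl_def)
  define K where "K = {0..int D} \<times> {R. R \<subseteq> {0..<int D} \<and> card R \<le> r} \<times> {F. F \<subseteq> {0..<int D} \<and> card F \<le> D div w}"
  define Y where "Y = (\<lambda>(u, R, F). gap_container (int D) w u R F)"
  have finsub: "finite {R. R \<subseteq> {0..<int D} \<and> card R \<le> i}" for i
    by (rule finite_subset[of _ "Pow {0..<int D}"]) auto
  have finK: "finite K" unfolding K_def using finsub by (intro finite_cartesian_product) auto
  have cardK: "card K \<le> (D + 1) ^ (1 + r + D div w)"
  proof -
    have "card K = (D + 1) * (card {R. R \<subseteq> {0..<int D} \<and> card R \<le> r} * card {F. F \<subseteq> {0..<int D} \<and> card F \<le> D div w})"
      by (simp add: K_def card_cartesian_product nat_add_distrib)
    also have "\<dots> \<le> (D + 1) * ((D + 1) ^ r * (D + 1) ^ (D div w))"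
      using card_small_subsets_le[of "{0..<int D}" r] card_small_subsets_le[of "{0..<int D}" "D div w"]
      by (intro mult_left_mono mult_mono) auto
    finally show ?thesis by (simp add: power_add)
  qed
  define T where "T = (\<lambda>(c, c'). {A. A \<subseteq> {0..<int L} \<and> card A = k \<and> A \<inter> Y c = {} \<and> refl A \<inter> Y c' = {}
      \<and> Y c \<subseteq> {0..<int D} \<and> Y c' \<subseteq> {0..<int D} \<and> J \<le> card (Y c) + card (Y c') + 2 * r + 2 * e})"
  have cardT: "card (T p) \<le> 2 ^ (2 * r + 2 * e) * (m choose k)" for p
  proof (cases "T p = {}")
    case False
    obtain c c' where p: "p = (c, c')" by (cases p)
    from False have Yc: "Y c \<subseteq> {0..<int D}" "Y c' \<subseteq> {0..<int D}"
      and J: "J \<le> card (Y c) + card (Y c') + 2 * r + 2 * e"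
      by (auto simp: T_def p)
    define U where "U = Y c \<union> refl (Y c')"
    have finU: "finite (Y c)" "finite (refl (Y c'))"
      using Yc finite_subset[of _ "{0..<int D}"] by (auto simp: refl_def)
    have Usub: "U \<subseteq> {0..<int L}" unfolding U_def refl_def using Yc DL L1 by fastforce
    have "Y c \<inter> refl (Y c') = {}" unfolding refl_def using Yc DL by fastforce
    then have cardU: "card U = card (Y c) + card (Y c')"
      unfolding U_def using finU by (simp add: card_Un_disjoint card_refl)
    have "T p \<subseteq> {A. A \<subseteq> {0..<int L} - U \<and> card A = k}"
    proof
      fix A assume A: "A \<in> T p"
      have "x \<notin> refl (Y c')" if "x \<in> A" for x
      proof
        assume "x \<in> refl (Y c')"
        then obtain y where y: "y \<in> Y c'" "x = int L - 1 - y" by (auto simp: refl_def)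
        then have "y = int L - 1 - x" by simp
        with \<open>x \<in> A\<close> have "y \<in> refl A" unfolding refl_def by blast
        with y A show False by (auto simp: T_def p)
      qed
      then show "A \<in> {A. A \<subseteq> {0..<int L} - U \<and> card A = k}"
        using A by (auto simp: T_def p U_def)
    qed
    moreover have "finite {A. A \<subseteq> {0..<int L} - U \<and> card A = k}"
      by (rule finite_subset[of _ "Pow {0..<int L}"]) auto
    ultimately have "card (T p) \<le> card {A. A \<subseteq> {0..<int L} - U \<and> card A = k}"
      by (intro card_mono)
    also have "\<dots> = (L - card U) choose k"
      using Usub finite_subset[OF Usub] by (simp add: n_subsets card_Diff_subset)
    also have "\<dots> \<le> (m + (2 * r + 2 * e)) choose k"
      using J cardU by (intro binomial_right_mono) (auto simp: L_def)
    also have "\<dots> \<le> 2 ^ (2 * r + 2 * e) * (m choose k)"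
      by (rule choose_add_le[OF km])
    finally show ?thesis .
  qed simp
  have cover: "A \<in> (\<Union>p\<in>K \<times> K. T p)" if A: "A \<in> ?S" "A \<notin> ?M" for A
  proof -
    have AL: "A \<subseteq> {0..<int L}" and cA: "card A = k" and cAA: "card (A + A) \<le> 2 * m"
      and mid: "\<And>z. z \<in> {D..2 * L - 2 - D} \<Longrightarrow> int z \<in> A + A"
      using A by auto
    have *: "\<exists>c\<in>K. A \<inter> Y c = {} \<and> Y c \<subseteq> {0..<int D} \<and>
        card ({0..<int D} - (A + A)) \<le> 2 * card (Y c) + 2 * r + 2 * e" if "A \<subseteq> {0..<int L}" for A
    proof -
      have A0: "A \<subseteq> {0..}" using that by auto
      have D0: "0 \<le> int D" and Dw': "nat (int D) * w \<le> r * e" using Dw by auto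
      obtain u R F where c: "u \<in> {0..int D}" "R \<subseteq> {0..<int D}" "F \<subseteq> {0..<int D}" "card R \<le> r"
        "card F * w \<le> nat (int D)" "A \<inter> gap_container (int D) w u R F = {}"
        "gap_container (int D) w u R F \<subseteq> {0..<int D}"
        "card ({0..<int D} - (A + A)) \<le> 2 * card (gap_container (int D) w u R F) + 2 * r + 2 * e"
        by (rule container_exists[OF A0 D0 w r Dw'])
      have "card F \<le> D div w" using c(5) w by (simp add: less_eq_div_iff_mult_less_eq)
      then show ?thesis using c by (intro bexI[of _ "(u, R, F)"]) (auto simp: Y_def K_def)
    qed
    obtain c where c: "c \<in> K" "A \<inter> Y c = {}" "Y c \<subseteq> {0..<int D}"
      "card ({0..<int D} - (A + A)) \<le> 2 * card (Y c) + 2 * r + 2 * e"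
      using *[OF AL] by blast
    obtain c' where c': "c' \<in> K" "refl A \<inter> Y c' = {}" "Y c' \<subseteq> {0..<int D}"
      "card ({0..<int D} - (refl A + refl A)) \<le> 2 * card (Y c') + 2 * r + 2 * e"
      using *[OF refl_sub[OF AL]] by blast
    define G where "G = {0..2 * int L - 2} - (A + A)"
    have AA: "A + A \<subseteq> {0..2 * int L - 2}"
    proof
      fix z assume "z \<in> A + A"
      then obtain x y where "x \<in> A" "y \<in> A" "z = x + y" by (auto simp: set_plus_def)
      moreover from this have "x \<in> {0..<int L}" "y \<in> {0..<int L}" using AL by auto
      ultimately show "z \<in> {0..2 * int L - 2}" by simp
    qed
    then have finAA: "finite (A + A)" by (rule finite_subset) simp
    have "card G = card {0..2 * int L - 2} - card (A + A)"
      unfolding G_def using finAA AA by (rule card_Diff_subset)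
    also have "card {0..2 * int L - 2} = 2 * L - 1" using L1 by simp
    finally have cG: "2 * L - 1 \<le> card G + 2 * m" using cAA by linarith
    have "G \<subseteq> ({0..<int D} - (A + A)) \<union> (\<lambda>z. 2 * (int L - 1) - z) ` ({0..<int D} - (refl A + refl A))"
    proof
      fix z assume z: "z \<in> G"
      then have z0: "0 \<le> z" "z \<le> 2 * int L - 2" "z \<notin> A + A" by (auto simp: G_def)
      have "nat z \<notin> {D..2 * L - 2 - D}" using mid[of "nat z"] z0 by auto
      then consider "z < int D" | "2 * (int L - 1) - z < int D"
        using z0 L1 by (auto simp: not_le nat_less_iff)
      then show "z \<in> ({0..<int D} - (A + A)) \<union> (\<lambda>z. 2 * (int L - 1) - z) ` ({0..<int D} - (refl A + refl A))"
      proof cases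
        case 2
        have "2 * (int L - 1) - z \<notin> refl A + refl A"
          unfolding refl_def reflect_sumset using z0 by auto
        then have "2 * (int L - 1) - z \<in> {0..<int D} - (refl A + refl A)" using 2 z0 by auto
        moreover have "z = 2 * (int L - 1) - (2 * (int L - 1) - z)" by simp
        ultimately show ?thesis by blast
      qed (use z0 in auto)
    qed
    then have "card G \<le> card (({0..<int D} - (A + A)) \<union> (\<lambda>z. 2 * (int L - 1) - z) ` ({0..<int D} - (refl A + refl A)))"
      by (intro card_mono) auto
    also have "\<dots> \<le> card ({0..<int D} - (A + A)) + card ((\<lambda>z. 2 * (int L - 1) - z) ` ({0..<int D} - (refl A + refl A)))"
      by (rule card_Un_le)
    also have "card ((\<lambda>z. 2 * (int L - 1) - z) ` ({0..<int D} - (refl A + refl A))) \<le> card ({0..<int D} - (refl A + refl A))"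
      by (rule card_image_le) simp
    finally have "J \<le> card (Y c) + card (Y c') + 2 * r + 2 * e"
      using c(4) c'(4) cG L1 by (simp add: L_def)
    then have "A \<in> T (c, c')" using AL cA c c' by (simp add: T_def)
    then show ?thesis using c c' by blast
  qed
  have finM: "finite ?M" by (rule finite_subset[of _ "Pow {0..<int L}"]) auto
  have finT: "finite (T p)" for p
    by (rule finite_subset[of _ "Pow {0..<int L}"]) (auto simp: T_def split: prod.splits)
  have "?S \<subseteq> ?M \<union> (\<Union>p\<in>K \<times> K. T p)" using cover by blast
  then have "card ?S \<le> card (?M \<union> (\<Union>p\<in>K \<times> K. T p))"
    using finM finT finK by (intro card_mono) auto
  also have "\<dots> \<le> card ?M + card (\<Union>p\<in>K \<times> K. T p)" by (rule card_Un_le)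
  also have "card (\<Union>p\<in>K \<times> K. T p) \<le> (\<Sum>p\<in>K \<times> K. card (T p))"
    using finK by (intro card_UN_le) auto
  also have "\<dots> \<le> card (K \<times> K) * (2 ^ (2 * r + 2 * e) * (m choose k))"
    using cardT by (metis sum_bounded_above of_nat_id)
  also have "\<dots> \<le> ((D + 1) ^ (1 + r + D div w))\<^sup>2 * (2 ^ (2 * r + 2 * e) * (m choose k))"
    using cardK by (intro mult_right_mono) (auto simp: card_cartesian_product power2_eq_square intro: mult_mono)
  finally show ?thesis by (simp add: mult.assoc)
qed

text \<open>
The logarithm of the number of containers for \<open>J = v\<^sup>2\<close>, with slack in the linear terms.
\<close>
lemma certificate_count_subexponential:
  fixes b c d \<eta> :: real
  assumes "0 < b" "0 < c" "0 < d" "0 < \<eta>"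
  shows "eventually (\<lambda>v::nat. 2 * (1 + c * v) * ln (b * v ^ 2 + 1) + d * v + 3
      \<le> \<eta> * v ^ 2) at_top"
  using assms by real_asymp

text \<open>
The comparison is with all \<open>k\<close>-subsets of \<open>{0..<m}\<close>: an excess length of \<open>v\<^sup>2\<close> costs no more than
\<open>exp (\<eta> * v\<^sup>2)\<close>, at an arbitrarily small rate \<open>\<eta>\<close>. The threshold \<open>v0\<close> depends only on \<open>\<Lambda>\<close> and \<open>\<eta>\<close>, which makes the bound usable
for excess lengths that tend to infinity.
\<close>
lemma few_sets_with_small_doubling:
  fixes \<Lambda> :: nat and \<eta> :: real
  assumes \<Lambda>: "1 \<le> \<Lambda>" and \<eta>: "0 < \<eta>"
  shows "\<exists>v0. \<forall>v\<ge>v0. \<exists>N. \<forall>k\<ge>N. \<forall>m. 2 * k \<le> m \<and> 2 * m \<le> \<Lambda> * k \<longrightarrow>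
    real (card {A. A \<subseteq> {0..<int (m + v\<^sup>2)} \<and> card A = k \<and> card (A + A) \<le> 2 * m})
      \<le> exp (\<eta> * real v ^ 2) * real (m choose k)"
proof -
  obtain B v1 where B: "1 \<le> B" and mid: "\<And>v L k. v1 \<le> v \<Longrightarrow> 4 \<le> k \<Longrightarrow> 1 \<le> L \<Longrightarrow> L \<le> \<Lambda> * k \<Longrightarrow>
    2 ^ v\<^sup>2 * card {A. A \<subseteq> {0..<int L} \<and> card A = k \<and>
        (\<exists>z\<in>{B * v\<^sup>2..2 * L - 2 - B * v\<^sup>2}. int z \<notin> A + A)} \<le> (L choose k)"
    using few_sets_miss_middle_sum[OF \<Lambda>] by blast
  obtain E :: nat where E: "4 / \<eta> < E" using reals_Archimedean2 by blast
  then have E0: "0 < E" using \<eta> by (metis divide_pos_pos less_trans of_nat_0_less_iff zero_less_numeral)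
  have ev: "eventually (\<lambda>v::nat. 2 * (1 + (real B * E + B) * v) * ln (real B * real v ^ 2 + 1) + 2 * (real B * E) * v + 3
      \<le> (\<eta> / 2) * real v ^ 2) at_top"
    using B E0 \<eta> by (intro certificate_count_subexponential) (auto intro!: add_pos_pos)
  then obtain v2 where v2: "\<And>v::nat. v2 \<le> v \<Longrightarrow> 2 * (1 + (real B * E + B) * v) * ln (real B * real v ^ 2 + 1) + 2 * (real B * E) * v + 3
      \<le> (\<eta> / 2) * real v ^ 2"
    unfolding eventually_sequentially by blast
  have main: "real (card {A. A \<subseteq> {0..<int (m + v\<^sup>2)} \<and> card A = k \<and> card (A + A) \<le> 2 * m})
      \<le> exp (\<eta> * real v ^ 2) * real (m choose k)"
    if v: "v1 \<le> v" "v2 \<le> v" "1 \<le> v" and k: "4 \<le> k" "2 * B * v\<^sup>2 \<le> k"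
      and m: "2 * k \<le> m" "2 * m \<le> \<Lambda> * k" for v k m
  proof -
    \<comment> \<open>With \<open>w = v\<close> and \<open>r\<close> of order \<open>v\<close>, a container is determined by \<open>O(v)\<close> elements of \<open>{0..D}\<close>,
      while the loss \<open>D * w / r\<close> is \<open>v\<^sup>2 / E\<close>, a small fraction of \<open>v\<^sup>2\<close>.\<close>
    define D where "D = B * v\<^sup>2"
    define r where "r = B * E * v"
    define e where "e = v\<^sup>2 div E + 1"
    define L where "L = m + v\<^sup>2"
    let ?M = "{A. A \<subseteq> {0..<int L} \<and> card A = k \<and> (\<exists>z\<in>{D..2 * L - 2 - D}. int z \<notin> A + A)}"
    let ?X = "((D + 1) ^ (1 + r + D div v))\<^sup>2 * 2 ^ (2 * r + 2 * e)"
    have "1 * v\<^sup>2 \<le> B * v\<^sup>2" using B by (rule mult_right_mono) simp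
    moreover have "2 * D \<le> k" using k(2) by (simp add: D_def)
    ultimately have "2 * v\<^sup>2 \<le> m" "2 * D \<le> m" using m unfolding D_def by linarith+
    then have L: "1 \<le> L" "L \<le> \<Lambda> * k" "2 * D \<le> L" using m k by (auto simp: L_def)
    have "v\<^sup>2 \<le> E * e"
    proof -
      have "v\<^sup>2 = E * (v\<^sup>2 div E) + v\<^sup>2 mod E" by simp
      also have "\<dots> \<le> E * (v\<^sup>2 div E) + E" using E0 by (intro add_left_mono less_imp_le) simp
      finally show ?thesis by (simp add: e_def)
    qed
    then have "B * v * v\<^sup>2 \<le> B * v * (E * e)" by (rule mult_left_mono) simp
    then have Dv: "D * v \<le> r * e" by (simp add: D_def r_def ac_simps)
    have r1: "1 \<le> r" using B E0 v by (simp add: r_def)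
    have "card {A. A \<subseteq> {0..<int L} \<and> card A = k \<and> card (A + A) \<le> 2 * m}
      \<le> card ?M + ?X * (m choose k)"
      unfolding L_def
      by (rule card_small_doubling_le[OF v(3) r1 Dv m(1)]) (use L in \<open>auto simp: L_def\<close>)
    also have "card ?M \<le> (m choose k)"
    proof -
      have "2 ^ v\<^sup>2 * card ?M \<le> (L choose k)"
        unfolding D_def using v(1) k(1) L by (intro mid)
      also have "\<dots> \<le> 2 ^ v\<^sup>2 * (m choose k)"
        unfolding L_def by (rule choose_add_le[OF m(1)])
      finally show ?thesis by simp
    qed
    also have "(m choose k) + ?X * (m choose k) = (1 + ?X) * (m choose k)" by simp
    finally have "card {A. A \<subseteq> {0..<int L} \<and> card A = k \<and> card (A + A) \<le> 2 * m}
        \<le> (1 + ?X) * (m choose k)" by simp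
    then have "real (card {A. A \<subseteq> {0..<int L} \<and> card A = k \<and> card (A + A) \<le> 2 * m})
        \<le> real (1 + ?X) * real (m choose k)"
      by (simp only: of_nat_mult[symmetric] of_nat_le_iff)
    also have "real (1 + ?X) \<le> exp (\<eta> * real v ^ 2)"
    proof -
      have Dvv: "D div v = B * v" using v(3) by (simp add: D_def power2_eq_square)
      have "0 < ?X" by (intro mult_pos_pos zero_less_power) auto
      then have "1 \<le> ?X" by linarith
      then have "real (1 + ?X) \<le> 2 * real ?X" by linarith
      also have "\<dots> = exp (ln 2 + 2 * (1 + real r + B * v) * ln (real D + 1) + (2 * real r + 2 * e) * ln 2)"
      proof -
        have "exp (2 * (1 + real r + B * v) * ln (real D + 1)) = (real D + 1) powr (real (2 * (1 + r + B * v)))"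
          by (simp add: powr_def)
        also have "\<dots> = (real D + 1) ^ (2 * (1 + r + B * v))" by (subst powr_realpow) auto
        finally have 1: "exp (2 * (1 + real r + B * v) * ln (real D + 1)) = (real D + 1) ^ (2 * (1 + r + B * v))" .
        have "exp ((2 * real r + 2 * e) * ln 2) = 2 powr (real (2 * r + 2 * e))"
          by (simp add: powr_def)
        also have "\<dots> = 2 ^ (2 * r + 2 * e)" by (subst powr_realpow) auto
        finally have 2: "exp ((2 * real r + 2 * e) * ln 2) = 2 ^ (2 * r + 2 * e)" .
        have "real ?X = (real D + 1) ^ (2 * (1 + r + B * v)) * 2 ^ (2 * r + 2 * e)"
          unfolding Dvv by (simp only: of_nat_mult of_nat_power of_nat_add of_nat_1 of_nat_numeral
              power_mult[symmetric] mult.commute[of _ 2])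
        then show ?thesis unfolding exp_add 1 2 by simp
      qed
      also have "\<dots> \<le> exp (\<eta> * real v ^ 2)"
      proof -
        have "real e \<le> real v ^ 2 / E + 1"
        proof -
          have "(v\<^sup>2 div E) * E \<le> v\<^sup>2" by simp
          then have "real ((v\<^sup>2 div E) * E) \<le> real (v\<^sup>2)" by (simp only: of_nat_le_iff)
          then have "real (v\<^sup>2 div E) \<le> real v ^ 2 / E" using E0 by (simp add: pos_le_divide_eq)
          then show ?thesis by (simp add: e_def)
        qed
        moreover have "real v ^ 2 / E \<le> (\<eta> / 4) * real v ^ 2"
        proof -
          have "1 / E \<le> \<eta> / 4" using E E0 \<eta> by (simp add: field_simps)
          then show ?thesis using mult_right_mono[of "1 / E" "\<eta> / 4" "real v ^ 2"] by simp
        qed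
        ultimately have e: "real e \<le> (\<eta> / 4) * real v ^ 2 + 1" by linarith
        have "ln 2 + (2 * real r + 2 * e) * ln 2 = (2 * real r + 2 * e + 1) * ln (2::real)"
          by (simp add: algebra_simps)
        also have "\<dots> \<le> (2 * real r + 2 * e + 1) * 1"
          using ln_2_less_1 by (intro mult_left_mono) auto
        also have "\<dots> \<le> 2 * (real B * E) * v + 3 + (\<eta> / 2) * real v ^ 2"
          using e by (simp add: r_def)
        finally have "ln 2 + 2 * (1 + real r + B * v) * ln (real D + 1) + (2 * real r + 2 * e) * ln 2
           \<le> 2 * (1 + (real B * E + B) * v) * ln (real B * real v ^ 2 + 1) + 2 * (real B * E) * v + 3
             + (\<eta> / 2) * real v ^ 2"
          by (simp add: r_def D_def algebra_simps)
        also have "\<dots> \<le> \<eta> * real v ^ 2" using v2[OF v(2)] by linarith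
        finally show ?thesis by simp
      qed
      finally show ?thesis .
    qed
    finally show ?thesis by (simp add: L_def mult_right_mono)
  qed
  show ?thesis
  proof (rule exI[of _ "Max {v1, v2, 1}"], intro allI impI)
    fix v assume v: "Max {v1, v2, 1} \<le> v"
    show "\<exists>N. \<forall>k\<ge>N. \<forall>m. 2 * k \<le> m \<and> 2 * m \<le> \<Lambda> * k \<longrightarrow>
    real (card {A. A \<subseteq> {0..<int (m + v\<^sup>2)} \<and> card A = k \<and> card (A + A) \<le> 2 * m})
      \<le> exp (\<eta> * real v ^ 2) * real (m choose k)"
      by (rule exI[of _ "max 4 (2 * B * v\<^sup>2)"], intro allI impI main) (use v in auto)
  qed
qed

section \<open>Progressions inside an interval\<close>

lemma card_affine_image:
  fixes d :: int
  assumes "d \<noteq> 0"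
  shows "card ((\<lambda>x. a + d * x) ` H) = card H"
  using assms by (intro card_image) (auto simp: inj_on_def)

lemma card_affine_sumset:
  fixes d :: int
  assumes "d \<noteq> 0"
  shows "card ((\<lambda>x. a + d * x) ` H + (\<lambda>x. a + d * x) ` H) = card (H + H)"
proof -
  have "(\<lambda>x. a + d * x) ` H + (\<lambda>x. a + d * x) ` H = (\<lambda>x. 2 * a + d * x) ` (H + H)"
  proof (intro set_eqI iffI)
    fix z assume "z \<in> (\<lambda>x. a + d * x) ` H + (\<lambda>x. a + d * x) ` H"
    then obtain x y where "x \<in> H" "y \<in> H" "z = 2 * a + d * (x + y)"
      by (auto simp: set_plus_def algebra_simps)
    then show "z \<in> (\<lambda>x. 2 * a + d * x) ` (H + H)" by blast
  next
    fix z assume "z \<in> (\<lambda>x. 2 * a + d * x) ` (H + H)"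
    then obtain x y where "x \<in> H" "y \<in> H" "z = (a + d * x) + (a + d * y)"
      by (auto simp: set_plus_def algebra_simps)
    then show "z \<in> (\<lambda>x. a + d * x) ` H + (\<lambda>x. a + d * x) ` H" by blast
  qed
  then show ?thesis using card_affine_image[OF assms] by simp
qed

text \<open>
A progression is represented by its first term and its difference.
\<close>
definition progs_inside :: "nat \<Rightarrow> nat \<Rightarrow> (int \<times> int) set" where
  "progs_inside n l = {(a, d). 1 \<le> a \<and> 1 \<le> d \<and> a + (int l - 1) * d \<le> int n}"

text \<open>
The residue classes that contain at least \<open>k\<close> elements of \<open>{1..n}\<close>, up to rounding, represented by
their smallest positive element and the modulus.
\<close>
definition large_classes :: "nat \<Rightarrow> nat \<Rightarrow> (int \<times> int) set" where
  "large_classes n k = {(a, d). 1 \<le> a \<and> a \<le> d \<and> d * (int k - 1) \<le> int n - 1}"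

text \<open>
A progression of length at most \<open>L\<close> around \<open>A\<close> can be taken of length exactly \<open>L\<close> and shifted into
\<open>{1..n}\<close>, unless the whole residue class has too few elements there. In that case it is shifted
until it starts at the first element of the class, and the class is large because it contains \<open>A\<close>.
\<close>
lemma subset_of_short_progression:
  assumes A: "A \<subseteq> {1..int n}" "card A = k" "1 \<le> k"
    and P: "is_arith_prog P" "A \<subseteq> P" "card P \<le> L"
  obtains a d H where "(a, d) \<in> progs_inside n L \<union> large_classes n k"
    "H \<subseteq> {0..<int L}" "A = (\<lambda>x. a + d * x) ` H"
proof -
  from P(1) obtain a0 d :: int and l :: nat where d: "1 \<le> d" and l: "1 \<le> l"
    and P_eq: "P = (\<lambda>i. a0 + int i * d) ` {..<l}"
    unfolding is_arith_prog_def by blast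
  have "card P = l" unfolding P_eq using d by (subst card_image) (auto simp: inj_on_def)
  with P(3) have lL: "l \<le> L" by simp
  have finA: "finite A" using A(1) by (rule finite_subset) simp
  have "A \<noteq> {}" using A by auto
  define \<mu> where "\<mu> = Min A"
  have \<mu>A: "\<mu> \<in> A" unfolding \<mu>_def using finA \<open>A \<noteq> {}\<close> by (rule Min_in)
  have \<mu>: "1 \<le> \<mu>" "\<mu> \<le> int n" using \<mu>A A(1) by auto
  have step: "\<exists>j. x = \<mu> + d * j \<and> 0 \<le> j \<and> j \<le> int L - 1" if x: "x \<in> A" for x
  proof -
    obtain i i0 where i: "i < l" "i0 < l" "x = a0 + int i * d" "\<mu> = a0 + int i0 * d"
      using x \<mu>A P(2) unfolding P_eq by blast
    have "\<mu> \<le> x" unfolding \<mu>_def using finA x by (rule Min_le)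
    then have "d * (int i - int i0) \<ge> 0" using i by (simp add: algebra_simps)
    then have "int i - int i0 \<ge> 0" using d by (simp add: zero_le_mult_iff)
    moreover have "x = \<mu> + d * (int i - int i0)" using i by (simp add: algebra_simps)
    moreover have "int i - int i0 \<le> int L - 1" using i lL by linarith
    ultimately show ?thesis by blast
  qed
  define fits where "fits = (\<lambda>i::nat. (\<mu> - int i * d) + (int L - 1) * d \<le> int n \<or> \<mu> - int i * d \<le> d)"
  have "\<mu> * 1 \<le> \<mu> * d" using \<mu> d by (intro mult_left_mono) auto
  then have "\<mu> - \<mu> * d \<le> d" using d by linarith
  then have "fits (nat \<mu>)" using \<mu> by (simp add: fits_def)
  \<comment> \<open>Start at \<open>Min A\<close> and shift down one step at a time, stopping as soon as the progression
    ends within \<open>{1..n}\<close> or starts within \<open>{1..d}\<close>. Before the last step it still ended above \<open>n\<close>, so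
    that \<open>A\<close> is not cut off at the top.\<close>
  define i where "i = (LEAST i. fits i)"
  have fits: "fits i" unfolding i_def using \<open>fits (nat \<mu>)\<close> by (rule LeastI)
  have not_fits: "\<not> fits i'" if "i' < i" for i'
    using that not_less_Least unfolding i_def by blast
  define a where "a = \<mu> - int i * d"
  have a1: "1 \<le> a"
  proof (cases i)
    case 0 then show ?thesis using \<mu> by (simp add: a_def)
  next
    case (Suc i')
    then show ?thesis using not_fits[of i'] by (auto simp: fits_def a_def algebra_simps)
  qed
  have in_prog: "\<exists>j\<in>{0..<int L}. x = a + d * j" if x: "x \<in> A" for x
  proof -
    obtain j where j: "x = \<mu> + d * j" "0 \<le> j" "j \<le> int L - 1" using step[OF x] by blast
    have "j + int i \<le> int L - 1"
    proof (cases i)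
      case 0 then show ?thesis using j by simp
    next
      case (Suc i')
      have "x \<le> int n" using x A(1) by auto
      also have "int n < (\<mu> - int i' * d) + (int L - 1) * d"
        using not_fits[of i'] Suc by (auto simp: fits_def)
      finally have "d * j < d * (int L - 1 - int i')" using j(1) by (simp add: algebra_simps)
      then have "j < int L - 1 - int i'" using d by simp
      then show ?thesis using Suc by simp
    qed
    moreover have "x = a + d * (j + int i)" using j(1) by (simp add: a_def algebra_simps)
    ultimately show ?thesis using j(2) by (intro bexI[of _ "j + int i"]) auto
  qed
  define H where "H = {j \<in> {0..<int L}. a + d * j \<in> A}"
  have "A = (\<lambda>x. a + d * x) ` H"
  proof (intro set_eqI iffI)
    fix x assume "x \<in> A"
    with in_prog[of x] obtain j where "j \<in> H" "x = a + d * j" by (auto simp: H_def)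
    then show "x \<in> (\<lambda>x. a + d * x) ` H" by blast
  qed (auto simp: H_def)
  moreover have "H \<subseteq> {0..<int L}" by (auto simp: H_def)
  moreover have "(a, d) \<in> progs_inside n L \<union> large_classes n k"
  proof (cases "a + (int L - 1) * d \<le> int n")
    case True then show ?thesis using a1 d by (simp add: progs_inside_def)
  next
    case False
    then have "a \<le> d" using fits by (auto simp: fits_def a_def)
    define J where "J = (int n - \<mu>) div d"
    have J0: "0 \<le> J" unfolding J_def using \<mu> d by (simp add: pos_imp_zdiv_nonneg_iff)
    have "A \<subseteq> (\<lambda>j. \<mu> + d * j) ` {0..J}"
    proof
      fix x assume x: "x \<in> A"
      obtain j where j: "x = \<mu> + d * j" "0 \<le> j" using step[OF x] by blast
      have "d * j \<le> int n - \<mu>" using x A(1) j by auto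
      then have "(d * j) div d \<le> J" unfolding J_def using d by (intro zdiv_mono1) auto
      then show "x \<in> (\<lambda>j. \<mu> + d * j) ` {0..J}" using j d by auto
    qed
    then have "card A \<le> card ((\<lambda>j. \<mu> + d * j) ` {0..J})" by (intro card_mono) auto
    also have "\<dots> \<le> card {0..J}" by (rule card_image_le) simp
    finally have "int k - 1 \<le> J" using A(2) J0 by simp
    then have "d * (int k - 1) \<le> d * J" using d by (intro mult_left_mono) auto
    also have "\<dots> \<le> int n - \<mu>"
      using mult_div_mod_eq[of d "int n - \<mu>"] pos_mod_sign[of d "int n - \<mu>"] d unfolding J_def by linarith
    also have "\<dots> \<le> int n - 1" using \<mu> by simp
    finally show ?thesis using a1 \<open>a \<le> d\<close> by (simp add: large_classes_def)
  qed
  ultimately show thesis using that by blast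
qed

lemma finite_progs_inside:
  assumes "2 \<le> l"
  shows "finite (progs_inside n l)"
proof (rule finite_subset)
  show "progs_inside n l \<subseteq> {1..int n} \<times> {1..int n}"
  proof clarify
    fix a d assume "(a, d) \<in> progs_inside n l"
    then have ad: "1 \<le> a" "1 \<le> d" "a + (int l - 1) * d \<le> int n" by (auto simp: progs_inside_def)
    have "1 * d \<le> (int l - 1) * d" using assms ad by (intro mult_right_mono) auto
    then show "a \<in> {1..int n} \<and> d \<in> {1..int n}"
      using ad unfolding atLeastAtMost_iff mult_1 by linarith
  qed
qed simp

lemma card_large_classes:
  assumes "2 \<le> k"
  shows "finite (large_classes n k)" "card (large_classes n k) * k\<^sup>2 \<le> 4 * n\<^sup>2"
proof -
  define q where "q = (n - 1) div (k - 1)"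
  have sub: "large_classes n k \<subseteq> {1..int q} \<times> {1..int q}"
  proof clarify
    fix a d assume "(a, d) \<in> large_classes n k"
    then have ad: "1 \<le> a" "a \<le> d" "d * (int k - 1) \<le> int n - 1" by (auto simp: large_classes_def)
    then have "0 \<le> d * (int k - 1)" using assms by simp
    then have n1: "1 \<le> n" using ad by linarith
    have "d \<le> (int n - 1) div (int k - 1)"
      using zdiv_mono1[OF ad(3), of "int k - 1"] assms by simp
    also have "\<dots> = int q" using n1 assms by (simp add: q_def zdiv_int of_nat_diff)
    finally show "a \<in> {1..int q} \<and> d \<in> {1..int q}" using ad by auto
  qed
  then show "finite (large_classes n k)" by (rule finite_subset) simp
  have "card (large_classes n k) \<le> q * q"
    using card_mono[OF _ sub] by (simp add: card_cartesian_product)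
  then have "card (large_classes n k) * (k * k) \<le> (q * q) * (k * k)" by (rule mult_right_mono) simp
  also have "\<dots> = (q * k) * (q * k)" by (simp only: mult_ac)
  finally have 1: "card (large_classes n k) * (k * k) \<le> (q * k) * (q * k)" .
  have qk: "q * k \<le> 2 * n"
  proof -
    have "q * k \<le> q * (2 * (k - 1))" using assms by (intro mult_left_mono) auto
    also have "\<dots> = 2 * (q * (k - 1))" by simp
    also have "q * (k - 1) \<le> n - 1" by (simp add: q_def)
    finally show ?thesis by linarith
  qed
  have "(q * k) * (q * k) \<le> (2 * n) * (2 * n)" by (rule mult_mono[OF qk qk]) auto
  from order.trans[OF 1 this] show "card (large_classes n k) * k\<^sup>2 \<le> 4 * n\<^sup>2"
    by (simp add: power2_eq_square)
qed

text \<open>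
Both counts on the left have at most the order of the number of progressions of length \<open>L'\<close>. If \<open>n\<close> is at least
twice \<open>L'\<close>, all of them are compared with \<open>n\<^sup>2 / L'\<close>. Otherwise only the differences \<open>1\<close> and \<open>2\<close>
occur for length \<open>L\<close>, the number of large classes is bounded in terms of \<open>\<Lambda>\<close>, and the intervals of
length \<open>L'\<close> alone suffice, because \<open>n - L'\<close> is large.
\<close>
lemma card_progs_comparison:
  fixes n k L L' \<Lambda> :: nat
  assumes k: "2 \<le> k" "4 * L' \<le> k\<^sup>2" "L' \<le> \<Lambda> * k"
    and L: "2 \<le> L" "2 \<le> L'" "L' + 2 \<le> 2 * L" "2 * L' + 3 \<le> 3 * L"
    and n: "2 * L' \<le> n + L" "L' + 16 * \<Lambda>\<^sup>2 \<le> n"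
  shows "card (progs_inside n L) + card (large_classes n k) \<le> 36 * card (progs_inside n L')"
proof -
  define T where "T = card (progs_inside n L')"
  define C where "C = card (large_classes n k)"
  have Ck: "C * k\<^sup>2 \<le> 4 * n\<^sup>2" unfolding C_def by (rule card_large_classes(2)[OF k(1)])
  have finT: "finite (progs_inside n L')" using L(2) by (rule finite_progs_inside)
  show ?thesis
  proof (cases "2 * L' \<le> n")
    case True
    define q where "q = n div (2 * L')"
    have "{1..int (n div 2)} \<times> {1..int q} \<subseteq> progs_inside n L'"
    proof clarify
      fix a d assume "a \<in> {1..int (n div 2)}" "d \<in> {1..int q}"
      then have ad: "1 \<le> a" "2 * a \<le> int n" "1 \<le> d" "d \<le> int q" by auto
      have "int L' * d \<le> int L' * int q" using ad by (intro mult_left_mono) auto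
      moreover have "(2 * L') * q \<le> n" by (simp add: q_def)
      then have "2 * (int L' * int q) \<le> int n" by (metis of_nat_mult of_nat_le_iff of_nat_numeral mult.assoc)
      ultimately have "2 * (int L' * d) \<le> int n" by linarith
      then show "(a, d) \<in> progs_inside n L'" using ad by (simp add: progs_inside_def algebra_simps)
    qed
    then have "card ({1..int (n div 2)} \<times> {1..int q}) \<le> T"
      unfolding T_def using finT by (intro card_mono)
    then have T: "(n div 2) * q \<le> T" by (simp add: card_cartesian_product)
    have "n \<le> 3 * (n div 2)" using True L(2) by presburger
    moreover have "n \<le> 4 * L' * q"
    proof -
      have "1 \<le> q" using True L(2) by (simp add: q_def div_greater_zero_iff Suc_le_eq)
      have "n mod (2 * L') < 2 * L'" using L(2) by simp
      then have "n \<le> 2 * L' * q + 2 * L'"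
        using mult_div_mod_eq[of "2 * L'" n] unfolding q_def by linarith
      moreover have "2 * L' * 1 \<le> 2 * L' * q" using \<open>1 \<le> q\<close> by (rule mult_left_mono) simp
      ultimately show ?thesis by linarith
    qed
    ultimately have "n * n \<le> (3 * (n div 2)) * (4 * L' * q)" by (rule mult_mono) auto
    also have "\<dots> = 12 * L' * ((n div 2) * q)" by simp
    also have "\<dots> \<le> 12 * L' * T" using T by (intro mult_left_mono) auto
    finally have nT: "n\<^sup>2 \<le> 12 * L' * T" by (simp add: power2_eq_square)
    have "k\<^sup>2 * C \<le> 4 * (12 * L' * T)" using Ck nT unfolding mult.commute[of "k\<^sup>2" C] by linarith
    also have "\<dots> = (4 * L') * (12 * T)" by simp
    also have "\<dots> \<le> k\<^sup>2 * (12 * T)" using k(2) by (rule mult_right_mono) simp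
    finally have C: "C \<le> 12 * T" using k(1) by simp
    have "progs_inside n L \<subseteq> {1..int n} \<times> {1..int (n div (L - 1))}"
    proof clarify
      fix a d assume "(a, d) \<in> progs_inside n L"
      then have ad: "1 \<le> a" "1 \<le> d" "a + (int L - 1) * d \<le> int n" by (auto simp: progs_inside_def)
      have "0 \<le> (int L - 1) * d" using ad L(1) by simp
      moreover have "(d * (int L - 1)) div (int L - 1) \<le> int n div (int L - 1)"
        using ad L(1) by (intro zdiv_mono1) (auto simp: mult.commute)
      then have "d \<le> int (n div (L - 1))" using L(1) by (simp add: zdiv_int of_nat_diff)
      ultimately show "a \<in> {1..int n} \<and> d \<in> {1..int (n div (L - 1))}" using ad by auto
    qed
    then have "card (progs_inside n L) \<le> card ({1..int n} \<times> {1..int (n div (L - 1))})"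
      by (intro card_mono) auto
    then have "(L - 1) * card (progs_inside n L) \<le> n * ((L - 1) * (n div (L - 1)))"
      by (simp add: card_cartesian_product)
    also have "\<dots> \<le> n * n" by (intro mult_left_mono) (auto simp: mult.commute)
    also have "\<dots> \<le> 12 * L' * T" using nT by (simp add: power2_eq_square)
    also have "\<dots> \<le> 12 * (2 * (L - 1)) * T" using L(3) by (intro mult_mono) auto
    also have "\<dots> = (L - 1) * (24 * T)" by simp
    finally have "card (progs_inside n L) \<le> 24 * T" using L(1) by simp
    then show ?thesis using C unfolding C_def T_def by linarith
  next
    case False
    have "(\<lambda>a. (a, 1)) ` {1..int n + 1 - int L'} \<subseteq> progs_inside n L'"
      by (auto simp: progs_inside_def)
    then have "card ((\<lambda>a. (a, 1::int)) ` {1..int n + 1 - int L'}) \<le> T"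
      unfolding T_def using finT by (intro card_mono)
    then have T: "n + 1 - L' \<le> T"
      by (subst (asm) card_image) (auto simp: inj_on_def)
    have "C * k\<^sup>2 \<le> 4 * (2 * (\<Lambda> * k))\<^sup>2"
    proof -
      have "n \<le> 2 * (\<Lambda> * k)" using False k(3) by linarith
      then have "4 * n\<^sup>2 \<le> 4 * (2 * (\<Lambda> * k))\<^sup>2" by (intro mult_left_mono power_mono) auto
      then show ?thesis using Ck by linarith
    qed
    also have "\<dots> = (16 * \<Lambda>\<^sup>2) * k\<^sup>2" by (simp add: power2_eq_square)
    finally have "C \<le> 16 * \<Lambda>\<^sup>2" using k(1) by simp
    then have C: "C \<le> T" using T n(2) by linarith
    have "progs_inside n L \<subseteq> {1..int n + 1 - int L} \<times> {1, 2}"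
    proof clarify
      fix a d assume "(a, d) \<in> progs_inside n L"
      then have ad: "1 \<le> a" "1 \<le> d" "a + (int L - 1) * d \<le> int n" by (auto simp: progs_inside_def)
      have "d < 3"
      proof (rule ccontr)
        assume "\<not> d < 3"
        define y where "y = (int L - 1) * d"
        have "(int L - 1) * 3 \<le> y" unfolding y_def
          using L(1) \<open>\<not> d < 3\<close> by (intro mult_left_mono) auto
        moreover have "a + y \<le> int n" unfolding y_def by (rule ad(3))
        moreover have "int n < 2 * int L'" "2 * int L' + 3 \<le> 3 * int L" using False L(4) by auto
        ultimately show False using ad(1) by (simp add: algebra_simps)
      qed
      moreover have "(int L - 1) * 1 \<le> (int L - 1) * d" using ad L(1) by (intro mult_left_mono) auto
      ultimately show "a \<in> {1..int n + 1 - int L} \<and> d \<in> {1, 2}" using ad by auto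
    qed
    then have "card (progs_inside n L) \<le> card ({1..int n + 1 - int L} \<times> {1, 2::int})"
      by (intro card_mono) auto
    then have "card (progs_inside n L) \<le> 2 * (n + 1 - L)"
      by (simp add: card_cartesian_product)
    then show ?thesis using C T n unfolding C_def T_def by linarith
  qed
qed

section \<open>Stretched sets\<close>

lemma card_subsets_containing:
  assumes "finite X" "x \<in> X" "1 \<le> j"
  shows "card {B. B \<subseteq> X \<and> card B = j \<and> x \<in> B} = (card X - 1) choose (j - 1)"
proof -
  have "{B. B \<subseteq> X \<and> card B = j \<and> x \<in> B} = insert x ` {B. B \<subseteq> X - {x} \<and> card B = j - 1}" (is "?S = _ ` ?T")
  proof (intro set_eqI iffI)
    fix B assume B: "B \<in> ?S"
    then have "finite B" using assms finite_subset by auto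
    then have "B - {x} \<in> ?T" "B = insert x (B - {x})" using B by auto
    then show "B \<in> insert x ` ?T" by blast
  next
    fix B assume "B \<in> insert x ` ?T"
    then obtain B' where B': "B' \<subseteq> X - {x}" "card B' = j - 1" "B = insert x B'" by auto
    then have "finite B'" "x \<notin> B'" using assms(1) finite_subset[of B' X] by auto
    then show "B \<in> ?S" using B' assms by auto
  qed
  moreover have "inj_on (insert x) ?T" by (auto simp: inj_on_def)
  ultimately show ?thesis using assms by (simp add: card_image n_subsets)
qed

text \<open>
Markov's inequality for \<open>card (B \<inter> Y)\<close>, whose mean over the \<open>j\<close>-subsets \<open>B\<close> of \<open>X\<close> is
\<open>j * card Y / card X\<close>.
\<close>
lemma few_subsets_concentrate:
  assumes X: "finite X" and Y: "Y \<subseteq> X"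
  shows "(c + 1) * card X * card {B. B \<subseteq> X \<and> card B = j \<and> c < card (B \<inter> Y)}
     \<le> card Y * j * (card X choose j)"
proof -
  define S where "S = {B. B \<subseteq> X \<and> card B = j}"
  have finS: "finite S" by (rule finite_subset[of _ "Pow X"]) (auto simp: S_def X)
  have finY: "finite Y" using X Y finite_subset by blast
  have "(c + 1) * card {B \<in> S. c < card (B \<inter> Y)} = (\<Sum>B\<in>{B \<in> S. c < card (B \<inter> Y)}. c + 1)" by simp
  also have "\<dots> \<le> (\<Sum>B\<in>{B \<in> S. c < card (B \<inter> Y)}. card (B \<inter> Y))" by (rule sum_mono) auto
  also have "\<dots> \<le> (\<Sum>B\<in>S. card (B \<inter> Y))" using finS by (intro sum_mono2) auto
  also have "\<dots> = (\<Sum>B\<in>S. \<Sum>y\<in>Y. if y \<in> B then 1 else 0)"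
  proof (rule sum.cong)
    fix B
    show "card (B \<inter> Y) = (\<Sum>y\<in>Y. if y \<in> B then 1 else 0)"
      using finY by (simp add: sum.If_cases Int_commute)
  qed simp
  also have "\<dots> = (\<Sum>y\<in>Y. \<Sum>B\<in>S. if y \<in> B then 1 else 0)" by (rule sum.swap)
  also have "\<dots> = (\<Sum>y\<in>Y. card {B \<in> S. y \<in> B})"
    using finS by (simp add: sum.If_cases Int_def)
  finally have *: "(c + 1) * card {B \<in> S. c < card (B \<inter> Y)} \<le> (\<Sum>y\<in>Y. card {B \<in> S. y \<in> B})" .
  have single: "card X * card {B \<in> S. y \<in> B} = j * (card X choose j)" if "y \<in> Y" for y
  proof (cases "j = 0")
    case True
    then have "{B \<in> S. y \<in> B} = {}" using X by (auto simp: S_def dest: finite_subset)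
    then show ?thesis using True by (simp only: card.empty)
  next
    case False
    have "{B \<in> S. y \<in> B} = {B. B \<subseteq> X \<and> card B = j \<and> y \<in> B}" by (auto simp: S_def)
    then show ?thesis
      using card_subsets_containing[of X y j] that X Y False times_binomial_minus1_eq[of j "card X"] by auto
  qed
  have "(c + 1) * card X * card {B \<in> S. c < card (B \<inter> Y)}
      = card X * ((c + 1) * card {B \<in> S. c < card (B \<inter> Y)})" by (simp only: mult_ac)
  also have "\<dots> \<le> card X * (\<Sum>y\<in>Y. card {B \<in> S. y \<in> B})" using * by (rule mult_left_mono) simp
  also have "\<dots> = (\<Sum>y\<in>Y. j * (card X choose j))" using single by (simp add: sum_distrib_left)
  also have "\<dots> = card Y * j * (card X choose j)" by simp
  finally show ?thesis by (simp add: S_def conj_assoc)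
qed

text \<open>
The candidates for the middle part of a stretched set: \<open>k - 3\<close> points in \<open>{2..<p}\<close>, of which at most
\<open>2 * s\<close> lie among the \<open>t\<close> largest elements of that interval.
\<close>
definition bodies :: "nat \<Rightarrow> nat \<Rightarrow> nat \<Rightarrow> nat \<Rightarrow> int set set" where
  "bodies p k s t =
     {B. B \<subseteq> {2..<int p} \<and> card B = k - 3 \<and> card (B \<inter> {int p - int t..<int p}) \<le> 2 * s}"

text \<open>
The isolated point at \<open>p - 1 + t\<close> makes the set long at the price of few sums. The points \<open>0\<close> and
\<open>1\<close> fix the left end and force the difference of every progression around the set.
\<close>
definition stretch :: "nat \<Rightarrow> nat \<Rightarrow> int set \<Rightarrow> int set" where
  "stretch p t B = {0, 1, int p - 1 + int t} \<union> B"

text \<open>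
On average \<open>t * (k - 3) / (p - 2)\<close> elements fall into the top part, which is at most \<open>3/2 * s\<close> by
hypothesis; so at least a quarter of the sets stay below \<open>2 * s + 1\<close>.
\<close>
lemma card_bodies_ge:
  assumes "3 \<le> k" "2 + t \<le> p" "2 * t * (k - 3) \<le> 3 * s * (p - 2)" "3 \<le> p"
  shows "((p - 2) choose (k - 3)) \<le> 4 * card (bodies p k s t)"
proof -
  define X where "X = {2..<int p}"
  define Y where "Y = {int p - int t..<int p}"
  define S where "S = {B. B \<subseteq> X \<and> card B = k - 3}"
  define Z where "Z = {B. B \<subseteq> X \<and> card B = k - 3 \<and> 2 * s < card (B \<inter> Y)}"
  have X: "finite X" "card X = p - 2" "Y \<subseteq> X" "card Y = t" using assms by (auto simp: X_def Y_def)
  have finS: "finite S" by (rule finite_subset[of _ "Pow X"]) (auto simp: S_def X)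
  have cS: "card S = (p - 2) choose (k - 3)" using X by (simp add: S_def n_subsets)
  have "(2 * s + 1) * (p - 2) * card Z \<le> t * (k - 3) * ((p - 2) choose (k - 3))"
    using few_subsets_concentrate[OF X(1,3), of "2 * s" "k - 3"] X by (simp add: Z_def)
  then have "2 * ((2 * s + 1) * (p - 2) * card Z) \<le> (2 * t * (k - 3)) * ((p - 2) choose (k - 3))" by simp
  also have "\<dots> \<le> (3 * s * (p - 2)) * ((p - 2) choose (k - 3))" using assms(3) by (rule mult_right_mono) simp
  finally have "(p - 2) * (2 * (2 * s + 1) * card Z) \<le> (p - 2) * (3 * s * card S)"
    unfolding cS by (simp only: mult_ac)
  moreover have "0 < p - 2" using assms(4) by simp
  ultimately have "2 * (2 * s + 1) * card Z \<le> 3 * s * card S" by (simp only: mult_le_cancel1 simp_thms)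
  have "(2 * s + 1) * (4 * card Z) \<le> (2 * s + 1) * (3 * card S)"
  proof -
    have "(2 * s + 1) * (4 * card Z) = 2 * (2 * (2 * s + 1) * card Z)" by simp
    also have "\<dots> \<le> 2 * (3 * s * card S)" using \<open>2 * (2 * s + 1) * card Z \<le> 3 * s * card S\<close> by simp
    also have "\<dots> \<le> (2 * s + 1) * (3 * card S)" by (simp add: algebra_simps)
    finally show ?thesis .
  qed
  then have "4 * card Z \<le> 3 * card S" by (subst (asm) mult_le_cancel1) auto
  moreover have "card (bodies p k s t) = card S - card Z"
  proof -
    have "bodies p k s t = S - Z" by (auto simp: bodies_def S_def Z_def X_def Y_def)
    moreover have "Z \<subseteq> S" by (auto simp: S_def Z_def)
    ultimately show ?thesis using card_Diff_subset[OF finite_subset[OF _ finS]] by simp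
  qed
  ultimately show ?thesis using cS by linarith
qed

text \<open>
The sums of two elements below \<open>p\<close> lie in \<open>{0..2 * p - 2}\<close>, and so does the sum of the isolated point
and an element \<open>h\<close>, unless \<open>h \<ge> p - t\<close>. The at most \<open>2 * s\<close> exceptional \<open>h\<close> and the double of the
isolated point bring the total to \<open>2 * p + 2 * s\<close>.
\<close>
lemma stretch_props:
  assumes "3 \<le> k" "2 + t \<le> p" "1 \<le> t" and B: "B \<in> bodies p k s t"
  shows "stretch p t B \<subseteq> {0..int p - 1 + int t}" "card (stretch p t B) = k"
    "card (stretch p t B + stretch p t B) \<le> 2 * (p + s)"
    "{0, 1, int p - 1 + int t} \<subseteq> stretch p t B" "stretch p t B \<inter> {2..<int p} = B"
proof -
  have Bsub: "B \<subseteq> {2..<int p}" and cB: "card B = k - 3"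
    and top: "card (B \<inter> {int p - int t..<int p}) \<le> 2 * s"
    using B by (auto simp: bodies_def)
  have finB: "finite B" using Bsub by (rule finite_subset) simp
  let ?x = "int p - 1 + int t"
  show "stretch p t B \<subseteq> {0..?x}" using Bsub assms by (auto simp: stretch_def)
  show "{0, 1, ?x} \<subseteq> stretch p t B" by (simp add: stretch_def)
  show "stretch p t B \<inter> {2..<int p} = B" using Bsub assms by (auto simp: stretch_def)
  have "card (stretch p t B) = card {0, 1, ?x} + card B"
    unfolding stretch_def using finB Bsub assms by (intro card_Un_disjoint) auto
  also have "card {0, 1, ?x} = 3" using assms by simp
  finally show "card (stretch p t B) = k" using cB assms by simp
  have "stretch p t B + stretch p t B \<subseteq>
      {0..2 * int p - 2} \<union> (\<lambda>h. ?x + h) ` (B \<inter> {int p - int t..<int p}) \<union> {2 * ?x}"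
  proof
    fix z assume "z \<in> stretch p t B + stretch p t B"
    then obtain x y where xy: "x \<in> stretch p t B" "y \<in> stretch p t B" "z = x + y"
      by (auto simp: set_plus_def)
    have mem: "h = ?x \<or> (0 \<le> h \<and> h \<le> int p - 1 \<and> (int p - int t \<le> h \<longrightarrow> h \<in> B))"
      if "h \<in> stretch p t B" for h
      using that Bsub assms by (auto simp: stretch_def)
    have one: "?x + h \<in> {0..2 * int p - 2} \<union> (\<lambda>h. ?x + h) ` (B \<inter> {int p - int t..<int p})"
      if h: "0 \<le> h" "h \<le> int p - 1" "int p - int t \<le> h \<longrightarrow> h \<in> B" for h
      using h assms by (cases "int p - int t \<le> h") auto
    show "z \<in> {0..2 * int p - 2} \<union> (\<lambda>h. ?x + h) ` (B \<inter> {int p - int t..<int p}) \<union> {2 * ?x}"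
      using mem[OF xy(1)] mem[OF xy(2)]
    proof (elim disjE)
      assume "x = ?x" "y = ?x"
      then show ?thesis using xy by simp
    next
      assume "x = ?x" "0 \<le> y \<and> y \<le> int p - 1 \<and> (int p - int t \<le> y \<longrightarrow> y \<in> B)"
      then show ?thesis using one[of y] unfolding xy(3) by blast
    next
      assume "y = ?x" "0 \<le> x \<and> x \<le> int p - 1 \<and> (int p - int t \<le> x \<longrightarrow> x \<in> B)"
      then show ?thesis using one[of x] unfolding xy(3) add.commute[of x y] by blast
    qed (use xy in auto)
  qed
  then have "card (stretch p t B + stretch p t B) \<le>
      card ({0..2 * int p - 2} \<union> (\<lambda>h. ?x + h) ` (B \<inter> {int p - int t..<int p}) \<union> {2 * ?x})"
    by (intro card_mono) auto
  also have "\<dots> \<le> card ({0..2 * int p - 2} \<union> (\<lambda>h. ?x + h) ` (B \<inter> {int p - int t..<int p})) + card {2 * ?x}"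
    by (rule card_Un_le)
  also have "\<dots> \<le> card {0..2 * int p - 2} + card ((\<lambda>h. ?x + h) ` (B \<inter> {int p - int t..<int p})) + card {2 * ?x}"
    by (intro add_right_mono card_Un_le)
  also have "card ((\<lambda>h. ?x + h) ` (B \<inter> {int p - int t..<int p})) \<le> card (B \<inter> {int p - int t..<int p})"
    by (rule card_image_le) simp
  finally show "card (stretch p t B + stretch p t B) \<le> 2 * (p + s)"
    using top assms by simp
qed

text \<open>
Two consecutive terms of a progression with difference \<open>d\<close> force the difference of any progression
that contains them to divide \<open>d\<close>.
\<close>
lemma progression_containing_stretch:
  assumes H: "{0, 1, int l - 1} \<subseteq> H" and d: "1 \<le> d" and l: "1 \<le> l"
    and P: "is_arith_prog P" "(\<lambda>x. a + d * x) ` H \<subseteq> P"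
  shows "l \<le> card P"
proof -
  from P(1) obtain b e :: int and q :: nat where e: "1 \<le> e"
    and P_eq: "P = (\<lambda>i. b + int i * e) ` {..<q}"
    unfolding is_arith_prog_def by blast
  have cP: "card P = q" unfolding P_eq using e by (subst card_image) (auto simp: inj_on_def)
  have "a + d * 0 \<in> P" "a + d * 1 \<in> P" "a + d * (int l - 1) \<in> P" using H P(2) by blast+
  then obtain i0 i1 i2 where i: "i0 < q" "i1 < q" "i2 < q" "a = b + int i0 * e" "a + d = b + int i1 * e"
    "a + d * (int l - 1) = b + int i2 * e"
    unfolding P_eq by auto
  have de: "d = (int i1 - int i0) * e" using i by (simp add: algebra_simps)
  then have "0 < (int i1 - int i0) * e" using d by simp
  then have "1 \<le> int i1 - int i0" using e by (simp add: zero_less_mult_iff)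
  then have "1 * e \<le> d" unfolding de using e by (intro mult_right_mono) auto
  then have "(int l - 1) * e \<le> (int l - 1) * d" using l by (intro mult_left_mono) auto
  also have "\<dots> = (int i2 - int i0) * e" using i by (simp add: algebra_simps)
  finally have "int l - 1 \<le> int i2 - int i0" using e by simp
  then show ?thesis using i(3) cP by linarith
qed

text \<open>
The smallest and the largest element of a stretched set determine the progression, and the progression
then determines the body.
\<close>
lemma card_stretched_progressions:
  assumes "3 \<le> k" "2 + t \<le> p" "1 \<le> t"
  shows "card ((\<lambda>((a, d), B). (\<lambda>x. a + d * x) ` stretch p t B) ` (progs_inside n (p + t) \<times> bodies p k s t))
     = card (progs_inside n (p + t)) * card (bodies p k s t)"
proof -
  let ?f = "\<lambda>((a, d), B). (\<lambda>x::int. a + d * x) ` stretch p t B"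
  let ?x = "int p - 1 + int t"
  have "inj_on ?f (progs_inside n (p + t) \<times> bodies p k s t)"
  proof (rule inj_onI)
    fix P P' assume mem: "P \<in> progs_inside n (p + t) \<times> bodies p k s t"
      "P' \<in> progs_inside n (p + t) \<times> bodies p k s t" and fP: "?f P = ?f P'"
    obtain a d B a' d' B' where PP': "P = ((a, d), B)" "P' = ((a', d'), B')" by (metis prod.exhaust)
    have ad: "(a, d) \<in> progs_inside n (p + t)" "(a', d') \<in> progs_inside n (p + t)"
      and B: "B \<in> bodies p k s t" "B' \<in> bodies p k s t"
      and eq: "(\<lambda>x. a + d * x) ` stretch p t B = (\<lambda>x. a' + d' * x) ` stretch p t B'"
      using mem fP by (simp_all add: PP')
    have d: "1 \<le> d" "1 \<le> d'" using ad by (auto simp: progs_inside_def)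
    note B1 = stretch_props[OF assms B(1)] and B2 = stretch_props[OF assms B(2)]
    have bounds: "a \<le> y \<and> y \<le> a + d * ?x" if bnd: "1 \<le> d" "H \<subseteq> {0..?x}" "y \<in> (\<lambda>x. a + d * x) ` H" for a d y H
    proof -
      obtain h where h: "y = a + d * h" "0 \<le> h" "h \<le> ?x" using bnd by auto
      then have "0 \<le> d * h" "d * h \<le> d * ?x" using bnd by (auto intro: mult_left_mono)
      then show ?thesis using h by simp
    qed
    have ends: "a + d * 0 \<in> (\<lambda>x. a + d * x) ` H" "a + d * ?x \<in> (\<lambda>x. a + d * x) ` H"
      if "{0, 1, ?x} \<subseteq> H" for a d H
      using that by blast+
    have "a = a'"
      using bounds[OF d(1) B1(1), of a' a] bounds[OF d(2) B2(1), of a a'] ends[OF B1(4), of a d] ends[OF B2(4), of a' d']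
      unfolding eq by auto
    moreover have "a + d * ?x = a' + d' * ?x"
      using bounds[OF d(1) B1(1), of "a' + d' * ?x" a] bounds[OF d(2) B2(1), of "a + d * ?x" a']
        ends[OF B1(4), of a d] ends[OF B2(4), of a' d']
      unfolding eq by auto
    ultimately have "d * ?x = d' * ?x" by simp
    moreover have "?x \<noteq> 0" using assms by linarith
    ultimately have dd: "d = d'" by simp
    have "stretch p t B = stretch p t B'"
    proof -
      have "inj (\<lambda>x. a' + d' * x)" using d by (auto simp: inj_def)
      then show ?thesis using eq unfolding \<open>a = a'\<close> dd by (rule inj_image_eq_iff[THEN iffD1])
    qed
    then have "stretch p t B \<inter> {2..<int p} = stretch p t B' \<inter> {2..<int p}" by (rule arg_cong)
    then have "B = B'" unfolding B1(5) B2(5) .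
    then show "P = P'" using \<open>a = a'\<close> dd by (simp add: PP')
  qed
  from card_image[OF this] show ?thesis by (simp only: card_cartesian_product)
qed

section \<open>Counting short and long sets\<close>

lemma card_in_short_progression_le:
  assumes "2 \<le> k" "2 \<le> L"
  shows "card {A. A \<subseteq> {1..int n} \<and> card A = k \<and> card (A + A) \<le> c \<and>
            (\<exists>P. is_arith_prog P \<and> A \<subseteq> P \<and> card P \<le> L)}
    \<le> (card (progs_inside n L) + card (large_classes n k))
       * card {H. H \<subseteq> {0..<int L} \<and> card H = k \<and> card (H + H) \<le> c}"
proof -
  let ?S = "{A. A \<subseteq> {1..int n} \<and> card A = k \<and> card (A + A) \<le> c \<and>
            (\<exists>P. is_arith_prog P \<and> A \<subseteq> P \<and> card P \<le> L)}"
  let ?Q = "progs_inside n L \<union> large_classes n k"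
  let ?H = "{H. H \<subseteq> {0..<int L} \<and> card H = k \<and> card (H + H) \<le> c}"
  let ?f = "\<lambda>((a, d), H). (\<lambda>x::int. a + d * x) ` H"
  have finQ: "finite ?Q"
    using finite_progs_inside[OF assms(2)] card_large_classes(1)[OF assms(1)] by simp
  have finH: "finite ?H" by (rule finite_subset[of _ "Pow {0..<int L}"]) auto
  have "?S \<subseteq> ?f ` (?Q \<times> ?H)"
  proof
    fix A assume A: "A \<in> ?S"
    then obtain P where P: "is_arith_prog P" "A \<subseteq> P" "card P \<le> L" by blast
    have A': "A \<subseteq> {1..int n}" "card A = k" "1 \<le> k" using A assms by auto
    obtain a d H where adH: "(a, d) \<in> ?Q" "H \<subseteq> {0..<int L}" "A = (\<lambda>x. a + d * x) ` H"
      by (rule subset_of_short_progression[OF A' P])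
    have "d \<noteq> 0" using adH(1) by (auto simp: progs_inside_def large_classes_def)
    then have "card H = k" "card (H + H) \<le> c"
      using A card_affine_image[of d a H] card_affine_sumset[of d a H] adH(3) by auto
    then have "((a, d), H) \<in> ?Q \<times> ?H" using adH by simp
    moreover have "A = ?f ((a, d), H)" using adH(3) by simp
    ultimately show "A \<in> ?f ` (?Q \<times> ?H)" by (rule rev_image_eqI)
  qed
  then have "card ?S \<le> card (?f ` (?Q \<times> ?H))"
    using finQ finH by (intro card_mono finite_imageI finite_cartesian_product)
  also have "\<dots> \<le> card (?Q \<times> ?H)" using finQ finH by (intro card_image_le finite_cartesian_product)
  also have "\<dots> = card ?Q * card ?H" by (rule card_cartesian_product)
  also have "\<dots> \<le> (card (progs_inside n L) + card (large_classes n k)) * card ?H"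
    by (intro mult_right_mono card_Un_le) simp
  finally show ?thesis .
qed

lemma card_in_long_progressions_ge:
  assumes "3 \<le> k" "2 + t \<le> p" "1 \<le> t"
  shows "card (progs_inside n (p + t)) * card (bodies p k s t)
    \<le> card {A. A \<subseteq> {1..int n} \<and> card A = k \<and> card (A + A) \<le> 2 * (p + s) \<and>
            (\<forall>P. is_arith_prog P \<and> A \<subseteq> P \<longrightarrow> p + t \<le> card P)}"
proof -
  let ?S = "{A. A \<subseteq> {1..int n} \<and> card A = k \<and> card (A + A) \<le> 2 * (p + s) \<and>
            (\<forall>P. is_arith_prog P \<and> A \<subseteq> P \<longrightarrow> p + t \<le> card P)}"
  let ?f = "\<lambda>((a, d), B). (\<lambda>x::int. a + d * x) ` stretch p t B"
  have "?f ` (progs_inside n (p + t) \<times> bodies p k s t) \<subseteq> ?S"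
  proof (rule image_subsetI)
    fix P assume "P \<in> progs_inside n (p + t) \<times> bodies p k s t"
    then obtain a d B where P: "P = ((a, d), B)" "(a, d) \<in> progs_inside n (p + t)" "B \<in> bodies p k s t"
      by (metis SigmaE prod.exhaust)
    have ad: "1 \<le> a" "1 \<le> d" "a + (int (p + t) - 1) * d \<le> int n"
      using P(2) by (auto simp: progs_inside_def)
    note st = stretch_props[OF assms P(3)]
    define A where "A = (\<lambda>x. a + d * x) ` stretch p t B"
    have "A \<subseteq> {1..int n}"
    proof
      fix y assume "y \<in> A"
      then obtain h where "h \<in> stretch p t B" and y: "y = a + d * h" unfolding A_def by blast
      then have h: "y = a + d * h" "0 \<le> h" "h \<le> int p - 1 + int t" using st(1) by auto
      have "0 \<le> d * h" using ad h by simp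
      moreover have "d * h \<le> d * (int p - 1 + int t)" using ad h by (intro mult_left_mono) auto
      moreover have "d * (int p - 1 + int t) = (int (p + t) - 1) * d" by (simp add: algebra_simps)
      ultimately show "y \<in> {1..int n}" using ad h(1) unfolding atLeastAtMost_iff by linarith
    qed
    moreover have "card A = k" "card (A + A) \<le> 2 * (p + s)"
      unfolding A_def using card_affine_image[of d a "stretch p t B"] card_affine_sumset[of d a "stretch p t B"]
        ad st by auto
    moreover have "p + t \<le> card Q" if "is_arith_prog Q" "A \<subseteq> Q" for Q
    proof (rule progression_containing_stretch)
      have "int (p + t) - 1 = int p - 1 + int t" by simp
      then show "{0, 1, int (p + t) - 1} \<subseteq> stretch p t B" using st(4) by (simp only:)
      show "(\<lambda>x. a + d * x) ` stretch p t B \<subseteq> Q" using that by (simp add: A_def)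
      show "1 \<le> p + t" using assms by simp
    qed (use ad that in auto)
    ultimately show "?f P \<in> ?S" unfolding P(1) A_def by simp
  qed
  moreover have "finite ?S" by (rule finite_subset[of _ "Pow {1..int n}"]) auto
  ultimately have "card (?f ` (progs_inside n (p + t) \<times> bodies p k s t)) \<le> card ?S"
    by (intro card_mono)
  then show ?thesis using card_stretched_progressions[OF assms, of n s] by simp
qed

text \<open>
A lower bound for a probability without any estimate for the size of the sample space.
\<close>
lemma prob_ge_of_card_complement_le:
  assumes fin: "finite S" "S \<noteq> {}" and \<epsilon>: "0 \<le> \<epsilon>" "\<epsilon> \<le> 1 / 2"
    and le: "2 * \<epsilon> * real (card (S - E)) \<le> real (card (S \<inter> E))"
  shows "\<epsilon> \<le> measure_pmf.prob (pmf_of_set S) E"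
proof -
  have "card S = card (S \<inter> E) + card (S - E)"
    using card_Un_disjoint[of "S \<inter> E" "S - E"] fin by (simp add: Int_Diff_Un Int_Diff_disjoint)
  moreover have "\<epsilon> * real (card (S \<inter> E)) \<le> (1 / 2) * real (card (S \<inter> E))"
    using \<epsilon> by (intro mult_right_mono) auto
  ultimately have "\<epsilon> * real (card S) \<le> real (card (S \<inter> E))"
    using le by (simp add: distrib_left)
  moreover have "0 < card S" using fin by (simp add: card_gt_0_iff)
  ultimately show ?thesis
    using fin by (simp add: measure_pmf_of_set pos_le_divide_eq)
qed

(* "n, k sufficiently large" is read as: k and n - lam k / 2 both exceed a constant depending only
   on lam and \<epsilon>. Independent thresholds for n and k would make the claim false: if n < lam k / 2,
   then [n] itself is a progression that contains A and is too short. *)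
theorem proposition10p1:
  fixes lam :: real
  assumes "lam \<ge> 4"
  shows "\<exists>\<epsilon>\<^sub>0 > 0. \<forall>\<epsilon>. 0 < \<epsilon> \<and> \<epsilon> < \<epsilon>\<^sub>0 \<longrightarrow>
    (\<exists>N :: nat. \<forall>n k :: nat.
       k \<ge> N \<and> real n \<ge> lam * real k / 2 + real N \<and> lam * real k / 2 \<in> \<int> \<longrightarrow>
       measure_pmf.prob (pmf_of_set (small_sumset_family lam n k))
         {A. \<forall>P. is_arith_prog P \<and> A \<subseteq> P \<longrightarrow>
               real (card P) \<ge> lam * real k / 2 + lam\<^sup>2 * ln (1 / \<epsilon>) / 2 ^ 6}
       \<ge> \<epsilon>)"
proof -
  define \<Lambda> where "\<Lambda> = nat \<lceil>lam\<rceil>"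
  have \<Lambda>: "1 \<le> \<Lambda>" "lam \<le> real \<Lambda>" using assms by (auto simp: \<Lambda>_def le_nat_iff)
  obtain v0 where v0: "\<And>v. v0 \<le> v \<Longrightarrow> \<exists>N. \<forall>k\<ge>N. \<forall>m. 2 * k \<le> m \<and> 2 * m \<le> \<Lambda> * k \<longrightarrow>
    real (card {A. A \<subseteq> {0..<int (m + v\<^sup>2)} \<and> card A = k \<and> card (A + A) \<le> 2 * m})
      \<le> exp (1 / lam\<^sup>2 * real v ^ 2) * real (m choose k)"
    using few_sets_with_small_doubling[OF \<Lambda>(1), of "1 / lam\<^sup>2"] assms by auto
  define X where "X = 8 * ln (288 * lam ^ 3 * exp 6) + 4 * real v0 ^ 2 + 36"
  have X_ln: "0 \<le> ln (288 * lam ^ 3 * exp 6)"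
  proof -
    have "1 \<le> lam ^ 3" "1 \<le> exp (6::real)" using assms by (auto intro: one_le_power)
    then have "1 * 1 \<le> lam ^ 3 * exp (6::real)" using assms by (intro mult_mono) auto
    then show ?thesis by (intro ln_ge_zero) linarith
  qed
  have "\<exists>N :: nat. \<forall>n k :: nat.
       k \<ge> N \<and> real n \<ge> lam * real k / 2 + real N \<and> lam * real k / 2 \<in> \<int> \<longrightarrow>
       measure_pmf.prob (pmf_of_set (small_sumset_family lam n k))
         {A. \<forall>P. is_arith_prog P \<and> A \<subseteq> P \<longrightarrow>
               real (card P) \<ge> lam * real k / 2 + lam\<^sup>2 * ln (1 / \<epsilon>) / 2 ^ 6}
       \<ge> \<epsilon>" if \<epsilon>: "0 < \<epsilon>" "\<epsilon> < exp (- X)" for \<epsilon>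
  proof -
    define x where "x = ln (1 / \<epsilon>)"
    have \<epsilon>x: "\<epsilon> = exp (- x)" using \<epsilon>(1) by (simp add: x_def ln_div)
    then have x: "X < x" using \<epsilon>(2) by simp
    then have x36: "36 < x" and xv0: "4 * real v0 ^ 2 \<le> x" and x_ln: "8 * ln (288 * lam ^ 3 * exp 6) \<le> x"
      using X_ln zero_le_power2[of "real v0"] unfolding X_def by linarith+
    have lam2: "16 \<le> lam\<^sup>2" using power_mono[of 4 lam 2] assms by simp
    define C where "C = lam\<^sup>2 * x / 2 ^ 6"
    have "16 * x \<le> lam\<^sup>2 * x" using lam2 x36 by (intro mult_right_mono) auto
    then have Cx: "x \<le> 4 * C" by (simp add: C_def mult.commute)
    then have C9: "9 \<le> C" using x36 by linarith
    \<comment> \<open>The excess length is rounded up to a square, which at most doubles it.\<close>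
    define v where "v = nat \<lceil>sqrt C\<rceil>"
    have v: "sqrt C \<le> real v" "real v \<le> sqrt C + 1"
      using C9 by (auto simp: v_def of_nat_nat)
    have sqrtC: "3 \<le> sqrt C" using C9 by (intro real_le_rsqrt) simp
    have Cv: "C \<le> real (v\<^sup>2)"
      using power_mono[OF v(1), of 2] C9 by simp
    have vC: "real v ^ 2 \<le> 2 * C"
    proof -
      have "real v ^ 2 \<le> (sqrt C + 1) ^ 2" using v(2) by (intro power_mono) auto
      also have "\<dots> = C + 2 * sqrt C + 1" using C9 by (simp add: power2_sum)
      finally have "real v ^ 2 \<le> C + 2 * sqrt C + 1" .
      moreover have "3 * sqrt C \<le> sqrt C * sqrt C" using sqrtC C9 by (intro mult_right_mono) auto
      moreover have "sqrt C * sqrt C = C" using C9 by simp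
      ultimately show ?thesis using sqrtC by linarith
    qed
    have "real v0 \<le> real v"
    proof -
      have "real v0 ^ 2 \<le> C" using xv0 Cx by linarith
      then have "real v0 \<le> sqrt C" by (rule real_le_rsqrt)
      then show ?thesis using v(1) by linarith
    qed
    then obtain N1 where N1: "\<And>k m. N1 \<le> k \<Longrightarrow> 2 * k \<le> m \<Longrightarrow> 2 * m \<le> \<Lambda> * k \<Longrightarrow>
      real (card {A. A \<subseteq> {0..<int (m + v\<^sup>2)} \<and> card A = k \<and> card (A + A) \<le> 2 * m})
      \<le> exp (1 / lam\<^sup>2 * real v ^ 2) * real (m choose k)"
      using v0[of v] by auto
    \<comment> \<open>With \<open>t = lam * s / 2\<close>, about \<open>s\<close> elements of a random body lie in its top part, and the net
      gain in length is \<open>t - s \<ge> lam * s / 4\<close>; this is \<open>C\<close> for \<open>s = 4 * C / lam\<close>, and the additional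
      \<open>1\<close> makes up for rounding \<open>t\<close>.\<close>
    define s where "s = nat \<lceil>4 * C / lam\<rceil> + 1"
    define t where "t = nat \<lfloor>lam * real s / 2\<rfloor>"
    have Clam: "0 \<le> 4 * C / lam" using C9 assms by simp
    have s: "4 * C / lam + 1 \<le> real s" "real s \<le> 4 * C / lam + 2" "1 \<le> s"
    proof -
      have "real s = of_int \<lceil>4 * C / lam\<rceil> + 1" using Clam by (simp add: s_def of_nat_nat)
      then show "4 * C / lam + 1 \<le> real s" "real s \<le> 4 * C / lam + 2"
        using ceiling_correct[of "4 * C / lam"] by linarith+
    qed (simp add: s_def)
    have lams: "4 * 1 \<le> lam * real s" using assms s by (intro mult_mono) auto
    then have t: "lam * real s / 2 - 1 < real t" "real t \<le> lam * real s / 2" "1 \<le> t"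
    proof -
      have "real t = of_int \<lfloor>lam * real s / 2\<rfloor>" using lams by (simp add: t_def of_nat_nat)
      then show *: "lam * real s / 2 - 1 < real t" "real t \<le> lam * real s / 2"
        using floor_correct[of "lam * real s / 2"] by linarith+
      show "1 \<le> t" using *(1) lams by linarith
    qed
    have ts: "C + real s \<le> real t"
    proof -
      have "4 * C + lam = lam * (4 * C / lam + 1)" using assms by (simp add: field_simps)
      also have "\<dots> \<le> lam * real s" using s assms by (intro mult_left_mono) auto
      finally have "4 * C + lam \<le> lam * real s" .
      moreover have "4 * real s \<le> lam * real s" using assms by (intro mult_right_mono) auto
      ultimately show ?thesis using t(1) assms by linarith
    qed
    define N where "N = N1 + 2 * \<Lambda> + 4 * t + 3 * s + 16 * \<Lambda>\<^sup>2 + 10"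
    have main: "measure_pmf.prob (pmf_of_set (small_sumset_family lam n k))
         {A. \<forall>P. is_arith_prog P \<and> A \<subseteq> P \<longrightarrow> real (card P) \<ge> lam * real k / 2 + C} \<ge> \<epsilon>"
      if k: "N \<le> k" and n: "lam * real k / 2 + real N \<le> real n" and int: "lam * real k / 2 \<in> \<int>" for n k
    proof -
      obtain m where m: "real m = lam * real k / 2"
      proof -
        obtain i where i: "lam * real k / 2 = of_int i" using int by (auto elim: Ints_cases)
        moreover have "0 \<le> lam * real k / 2" using assms by simp
        ultimately have "real (nat i) = lam * real k / 2" by simp
        then show thesis by (rule that)
      qed
      have km: "2 * k \<le> m"
      proof -
        have "4 * real k \<le> lam * real k" using assms by (intro mult_right_mono) auto
        then have "real (2 * k) \<le> real m" using m by simp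
        then show ?thesis by (simp only: of_nat_le_iff)
      qed
      have mk: "2 * m \<le> \<Lambda> * k"
      proof -
        have "lam * real k \<le> real \<Lambda> * real k" using \<Lambda>(2) by (intro mult_right_mono) auto
        then have "real (2 * m) \<le> real (\<Lambda> * k)" using m by simp
        then show ?thesis by (simp only: of_nat_le_iff)
      qed
      have nm: "m + N \<le> n"
      proof -
        have "real (m + N) \<le> real n" using n m by simp
        then show ?thesis by (simp only: of_nat_le_iff)
      qed
      define p where "p = m - s"
      define L where "L = m + v\<^sup>2"
      have k_ge: "N1 \<le> k" "2 * \<Lambda> + 4 * t \<le> k" "4 * t + 3 * s + 10 \<le> k"
        using k by (auto simp: N_def)
      have ps: "p + s = m" "2 + t \<le> p" "3 \<le> p" using km k_ge(3) by (auto simp: p_def)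
      define S where "S = small_sumset_family lam n k"
      define E where "E = {A. \<forall>P. is_arith_prog P \<and> A \<subseteq> P \<longrightarrow> real (card P) \<ge> lam * real k / 2 + C}"
      define T where "T = card (progs_inside n (p + t))"
      have S_iff: "A \<in> S \<longleftrightarrow> A \<subseteq> {1..int n} \<and> card A = k \<and> card (A + A) \<le> 2 * m" for A
      proof -
        have "lam * real k = real (2 * m)" using m by simp
        then show ?thesis by (simp only: S_def small_sumset_family_def mem_Collect_eq of_nat_le_iff)
      qed
      have finS: "finite S" unfolding S_def by (rule finite_small_sumset_family)
      have "S \<noteq> {}" unfolding S_def using assms km nm by (intro small_sumset_family_nonempty) auto
      have good: "T * ((p - 2) choose (k - 3)) \<le> 4 * card (S \<inter> E)"
      proof -
        have "2 * t * (k - 3) \<le> 3 * s * (p - 2)"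
        proof -
          have sm: "3 * real s + 6 \<le> real m" using km k_ge(3) by linarith
          have "2 * real t * real (k - 3) \<le> lam * real s * real (k - 3)"
            using t(2) by (intro mult_right_mono) auto
          also have "\<dots> = real s * (lam * (real k - 3))" using k_ge(3) by (simp add: of_nat_diff)
          also have "\<dots> \<le> real s * (3 * real (p - 2))"
          proof (rule mult_left_mono)
            have "real (p - 2) = real m - real s - 2" using ps by (simp add: of_nat_diff p_def)
            then show "lam * (real k - 3) \<le> 3 * real (p - 2)"
              using sm m assms by (simp add: algebra_simps)
          qed simp
          finally have "real (2 * t * (k - 3)) \<le> real (3 * s * (p - 2))" by simp
          then show ?thesis by (simp only: of_nat_le_iff)
        qed
        then have "((p - 2) choose (k - 3)) \<le> 4 * card (bodies p k s t)"
          using k_ge(3) ps by (intro card_bodies_ge) auto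
        then have "T * ((p - 2) choose (k - 3)) \<le> T * (4 * card (bodies p k s t))"
          by (rule mult_left_mono) simp
        also have "\<dots> = 4 * (T * card (bodies p k s t))" by simp
        also have "T * card (bodies p k s t) \<le> card {A. A \<subseteq> {1..int n} \<and> card A = k \<and>
            card (A + A) \<le> 2 * (p + s) \<and> (\<forall>P. is_arith_prog P \<and> A \<subseteq> P \<longrightarrow> p + t \<le> card P)}"
          unfolding T_def using k_ge(3) ps t(3) by (intro card_in_long_progressions_ge) auto
        also have "\<dots> \<le> card (S \<inter> E)"
        proof (rule card_mono)
          show "finite (S \<inter> E)" using finS by simp
          have "lam * real k / 2 + C \<le> real (p + t)"
          proof -
            have "real p = real m - real s" using ps by (simp add: p_def of_nat_diff)
            then show ?thesis using ts m by simp
          qed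
          then have "lam * real k / 2 + C \<le> real (card P)" if "p + t \<le> card P" for P :: "int set"
            using that by linarith
          then show "{A. A \<subseteq> {1..int n} \<and> card A = k \<and>
            card (A + A) \<le> 2 * (p + s) \<and> (\<forall>P. is_arith_prog P \<and> A \<subseteq> P \<longrightarrow> p + t \<le> card P)} \<subseteq> S \<inter> E"
            unfolding ps(1) by (auto simp: S_iff E_def)
        qed
        finally show ?thesis by simp
      qed
      have "card (S - E) \<le> (card (progs_inside n L) + card (large_classes n k))
          * card {H. H \<subseteq> {0..<int L} \<and> card H = k \<and> card (H + H) \<le> 2 * m}"
      proof -
        have "S - E \<subseteq> {A. A \<subseteq> {1..int n} \<and> card A = k \<and> card (A + A) \<le> 2 * m \<and>
            (\<exists>P. is_arith_prog P \<and> A \<subseteq> P \<and> card P \<le> L)}"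
        proof
          fix A assume A: "A \<in> S - E"
          then obtain P where P: "is_arith_prog P" "A \<subseteq> P" "real (card P) < lam * real k / 2 + C"
            by (auto simp: E_def not_le)
          then have "real (card P) \<le> real L" using Cv m by (simp add: L_def)
          then have "card P \<le> L" by (simp only: of_nat_le_iff)
          then show "A \<in> {A. A \<subseteq> {1..int n} \<and> card A = k \<and> card (A + A) \<le> 2 * m \<and>
            (\<exists>P. is_arith_prog P \<and> A \<subseteq> P \<and> card P \<le> L)}" using A P by (auto simp: S_iff)
        qed
        then have "card (S - E) \<le> card {A. A \<subseteq> {1..int n} \<and> card A = k \<and> card (A + A) \<le> 2 * m \<and>
            (\<exists>P. is_arith_prog P \<and> A \<subseteq> P \<and> card P \<le> L)}"
          by (rule card_mono[rotated]) (rule finite_subset[of _ "Pow {1..int n}"], auto)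
        also have "\<dots> \<le> (card (progs_inside n L) + card (large_classes n k))
          * card {H. H \<subseteq> {0..<int L} \<and> card H = k \<and> card (H + H) \<le> 2 * m}"
          using k_ge km by (intro card_in_short_progression_le) (auto simp: L_def)
        finally show ?thesis .
      qed
      also have "\<dots> \<le> (36 * T) * card {H. H \<subseteq> {0..<int L} \<and> card H = k \<and> card (H + H) \<le> 2 * m}"
      proof (rule mult_right_mono)
        have pt: "p + t \<le> m + t" by (simp add: p_def)
        show "card (progs_inside n L) + card (large_classes n k) \<le> 36 * T"
          unfolding T_def
        proof (rule card_progs_comparison)
          have "4 * (p + t) \<le> 2 * (2 * m) + 4 * t" using pt by simp
          also have "\<dots> \<le> 2 * (\<Lambda> * k) + 4 * t" using mk by (intro add_mono mult_left_mono) auto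
          also have "\<dots> \<le> 2 * (\<Lambda> * k) + 4 * t * k" using k_ge(3) by simp
          also have "\<dots> = (2 * \<Lambda> + 4 * t) * k" by (simp add: algebra_simps)
          also have "\<dots> \<le> k * k" using k_ge(2) by (rule mult_right_mono) simp
          finally show "4 * (p + t) \<le> k\<^sup>2" by (simp add: power2_eq_square)
          have "p + t \<le> 2 * m" using pt km k_ge(3) by linarith
          also have "\<dots> \<le> \<Lambda> * k" by (rule mk)
          finally show "p + t \<le> \<Lambda> * k" .
          show "p + t + 2 \<le> 2 * L" "2 * (p + t) + 3 \<le> 3 * L" "2 * (p + t) \<le> n + L"
            "p + t + 16 * \<Lambda>\<^sup>2 \<le> n" "2 \<le> k" "2 \<le> L" "2 \<le> p + t"
          proof -
            define u where "u = 16 * \<Lambda>\<^sup>2"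
            have "m \<le> L" "p \<le> m" "m + 4 * t + u + 10 \<le> n" "4 * t + 10 \<le> k"
              using nm k_ge(3) by (simp_all add: L_def p_def N_def u_def)
            then show "p + t + 2 \<le> 2 * L" "2 * (p + t) + 3 \<le> 3 * L" "2 * (p + t) \<le> n + L"
              "p + t + 16 * \<Lambda>\<^sup>2 \<le> n" "2 \<le> k" "2 \<le> L" "2 \<le> p + t"
              using km ps(3) unfolding u_def[symmetric] distrib_left by linarith+
          qed
        qed
      qed simp
      finally have "real (card (S - E))
          \<le> real (36 * T) * real (card {H. H \<subseteq> {0..<int L} \<and> card H = k \<and> card (H + H) \<le> 2 * m})"
        by (simp only: of_nat_mult[symmetric] of_nat_le_iff)
      also have "\<dots> \<le> real (36 * T) * (exp (1 / lam\<^sup>2 * real v ^ 2) * real (m choose k))"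
        unfolding L_def using k_ge(1) km mk by (intro mult_left_mono N1) auto
      also have "\<dots> \<le> real (36 * T) * (exp (x / 32) * real (m choose k))"
      proof -
        have "1 / lam\<^sup>2 * real v ^ 2 \<le> 1 / lam\<^sup>2 * (2 * C)"
          using vC by (intro mult_left_mono) auto
        also have "\<dots> = x / 32" using assms by (simp add: C_def)
        finally show ?thesis by (intro mult_left_mono mult_right_mono) auto
      qed
      finally have bad: "real (card (S - E)) \<le> 36 * real T * exp (x / 32) * real (m choose k)"
        by simp
      \<comment> \<open>Since \<open>s\<close> is about \<open>lam * x / 16\<close>, shortening the block costs \<open>\<epsilon> powr (3 / 4)\<close> up to a constant.\<close>
      have shrink: "exp (- (3 / 4) * x - 6) * real (m choose k) \<le> lam ^ 3 * real ((p - 2) choose (k - 3))"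
      proof -
        have "12 * real s / lam \<le> 12 * (4 * C / lam + 2) / lam"
          using s(2) assms by (intro divide_right_mono) auto
        also have "\<dots> = 3 / 4 * x + 24 / lam"
          using assms by (simp add: C_def field_simps power2_eq_square)
        also have "24 / lam \<le> 6" using assms by (simp add: field_simps)
        finally have "exp (- (3 / 4) * x - 6) \<le> exp (- 12 * real s / lam)" by simp
        then have "exp (- (3 / 4) * x - 6) * real (m choose k) \<le> exp (- 12 * real s / lam) * real (m choose k)"
          by (rule mult_right_mono) simp
        also have "\<dots> \<le> lam ^ 3 * real ((m - s - 2) choose (k - 3))"
          using assms m k_ge(3) km s(3) by (intro choose_shrink) auto
        finally show ?thesis by (simp add: p_def)
      qed
      have "2 * \<epsilon> * real (card (S - E)) \<le> real (card (S \<inter> E))"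
      proof -
        \<comment> \<open>The factor \<open>288 = 4 * 2 * 36\<close> collects the constants of both counts. It is absorbed by
          \<open>exp (x / 8)\<close>, because \<open>\<epsilon> powr (3 / 4)\<close> exceeds \<open>\<epsilon> * exp (x / 32)\<close> by \<open>exp (7 * x / 32)\<close>.\<close>
        define c where "c = 288 * lam ^ 3"
        have c0: "0 < c" using assms by (simp add: c_def)
        have "c * exp 6 = exp (ln (c * exp 6))" using c0 by simp
        also have "\<dots> \<le> exp (x / 8)" using x_ln by (simp add: c_def)
        finally have cx: "c * exp 6 \<le> exp (x / 8)" .
        have "c * (\<epsilon> * exp (x / 32)) = c * exp 6 * exp (- x + x / 32 - 6)"
          unfolding \<epsilon>x by (simp add: exp_add[symmetric] mult.assoc)
        also have "\<dots> \<le> exp (x / 8) * exp (- x + x / 32 - 6)"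
          using cx by (rule mult_right_mono) simp
        also have "\<dots> = exp (x / 8 + (- x + x / 32 - 6))" by (rule exp_add[symmetric])
        also have "\<dots> \<le> exp (- (3 / 4) * x - 6)" using x36 by simp
        finally have ce: "c * (\<epsilon> * exp (x / 32)) \<le> exp (- (3 / 4) * x - 6)" .
        have "(4 * lam ^ 3) * (2 * \<epsilon> * real (card (S - E)))
            \<le> (4 * lam ^ 3) * (2 * \<epsilon> * (36 * real T * exp (x / 32) * real (m choose k)))"
          using bad \<epsilon>(1) assms by (intro mult_left_mono) auto
        also have "\<dots> = real T * (c * (\<epsilon> * exp (x / 32)) * real (m choose k))" by (simp add: c_def)
        also have "\<dots> \<le> real T * (exp (- (3 / 4) * x - 6) * real (m choose k))"
          using ce by (intro mult_left_mono mult_right_mono) auto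
        also have "\<dots> \<le> real T * (lam ^ 3 * real ((p - 2) choose (k - 3)))"
          using shrink by (intro mult_left_mono) auto
        also have "\<dots> = lam ^ 3 * real (T * ((p - 2) choose (k - 3)))" by simp
        also have "\<dots> \<le> lam ^ 3 * real (4 * card (S \<inter> E))"
          using good assms by (intro mult_left_mono of_nat_mono) auto
        also have "\<dots> = (4 * lam ^ 3) * real (card (S \<inter> E))" by simp
        finally show ?thesis using assms by (subst (asm) mult_le_cancel_left_pos) auto
      qed
      moreover have "\<epsilon> \<le> 1 / 2"
      proof -
        have "1 + 36 \<le> exp (36::real)" by (rule exp_ge_add_one_self)
        also have "\<dots> \<le> exp x" using x36 by simp
        finally have "2 \<le> exp x" by simp
        then show ?thesis unfolding \<epsilon>x by (simp add: exp_minus field_simps)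
      qed
      ultimately have "\<epsilon> \<le> measure_pmf.prob (pmf_of_set S) E"
        using finS \<open>S \<noteq> {}\<close> \<epsilon>(1) by (intro prob_ge_of_card_complement_le) auto
      then show ?thesis by (simp only: S_def E_def)
    qed
    show ?thesis
      using main unfolding C_def x_def by (intro exI[of _ N]) blast
  qed
  then show ?thesis by (intro exI[of _ "exp (- X)"]) auto
qed

end
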